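(* Let $n\ge1$ and $w\in S_n$. Then: (1) $\displaystyle\mathfrak G^{(1)}_w=x_1^{n-1}x_2^{n-2}\cdots x_{n-1}\sum_{p\in\mathsf{paths}_{\overline{\mathcal G}_n}(w,w_0)}\frac{1}{\mathtt{wt}(p)}$; (2) $\displaystyle\mathfrak S_w=x_1^{n-1}x_2^{n-2}\cdots x_{n-1}\sum_{p\in\mathsf{paths}_{\mathcal G_n}(w,w_0)}\frac1{\mathtt{wt}(p)}$; (3) $\displaystyle\mathfrak G^{(1)}_w=\sum_{\substack{p\in\mathsf{paths}_{\mathcal R_n}(w,w_0)\\ p\text{ reduced}}}\mathfrak S_{w_0\cdot\delta(\mathsf{word}(p))}$; (4) $\displaystyle\mathfrak S_w=\sum_{p\in\mathsf{paths}_{\mathcal G_n}(w,w_0)}\mathfrak G_{w_0\cdot\delta(\mathsf{word}(p))}$.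
   Context: $S_n$ symmetric group, $s_i=(i\ i+1)$, $t_{a,b}=(a\ b)$, $w_0=n\,n-1\cdots1$; permutations in $S_n$ are also viewed as permutations of $\mathbb Z_{>0}$ fixing all $i>n$, and Bruhat order is used throughout. $N_i(f)=(f-s_i\cdot f)/(x_i-x_{i+1})$. Schubert: $\mathfrak S_{w_0}=x_1^{n-1}\cdots x_{n-1}$, $\mathfrak S_{ws_i}=N_i(\mathfrak S_w)$ if $w(i)>w(i+1)$. Grothendieck with parameter $\beta$: $\mathfrak G^{(\beta)}_{w_0}=x_1^{n-1}\cdots x_{n-1}$, $\mathfrak G^{(\beta)}_{ws_i}=N_i((1+\beta x_{i+1})\mathfrak G^{(\beta)}_w)$ if $w(i)>w(i+1)$; $\mathfrak G_w=\mathfrak G^{(-1)}_w$. Demazure product of a word: $\delta(\emptyset)=\mathrm{id}$, $\delta(a_1,\dots,a_k)=\delta(a_1,\dots,a_{k-1})*\tau_{a_k}$, $v*\tau_m=vs_m$ if $\ell(vs_m)>\ell(v)$, else $v$. Rothe diagram: $D(w)=\{(i,j):j<w(i),\ i<w^{-1}(j)\}$. For a partition $\lambda$ (possibly empty) the Young diagram is $\mathbb Y_\lambda=\{(i,j):1\le j\le\lambda_i\}$; $\mathrm{dom}(w)$ is the largest Young diagram contained in $D(w)$. An addable cell of $\mathbb Y_\lambda$ is $(i,j)\notin\mathbb Y_\lambda$ with $(i-1,j)\in\mathbb Y_\lambda$ if $i>1$ and $(i,j-1)\in\mathbb Y_\lambda$ if $j>1$. For $w\ne w_0$, $\alpha(w)$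 is the smallest column $j$ such that $\mathrm{dom}(w)$ has an addable cell $(i,j)$ with $i+j\le n$. For $w$ and $i$, let $\phi_i(w)=\{a>i: w(a)>w(i),\text{ and there is no }a'\text{ with } i<a'<a,\ w(i)<w(a')<w(a)\}$, $\Phi_i(w)=\{wt_{i,a}:a\in\phi_i(w)\}$, and $\overline\Phi_i(w)=\{wt_{i,i_k}t_{i,i_{k-1}}\cdots t_{i,i_1}:\emptyset\ne\{i_1<\cdots<i_k\}\subseteq\phi_i(w)\}$. Three directed edge-labeled graphs with vertex set $S_n$: for each $w\ne w_0$, let $j=\alpha(w)$ and $i=w^{-1}(j)$. In $\mathcal G_n$ there is an edge $w\xrightarrow{(i,j)}u$ for each $u\in\Phi_i(w)$; in $\overline{\mathcal G}_n$ for each $u\in\overline\Phi_i(w)$; in $\mathcal R_n$ for each $u\in\overline\Phi_i(w)$ with $u\ge ws_i$. For a directed path $p: u_1\xrightarrow{(i_1,j_1)}u_2\xrightarrow{(i_2,j_2)}\cdots\xrightarrow{(i_{k-1},j_{k-1})}u_k$, set $\mathsf{word}(p)=(i_{k-1},i_{k-2},\dots,i_1)$ and $\mathtt{wt}(p)=\prod_{h=1}^{k-1}x_{i_h}$; $p$ is reduced if $\mathsf{word}(p)$ is a reduced word. $\mathsf{paths}_\heartsuit(u,v)$ is the set of directed paths in $\heartsuit$ from $u$ to $v$ (including the empty path when $u=v$). *)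

theory Defs
  imports
    "HOL-Library.Poly_Mapping"
    "HOL-Combinatorics.Permutations"
    "HOL-Computational_Algebra.Polynomial_Factorial"
    "Graph_Theory.Arc_Walk"
begin

text \<open>
  A permutation in \<open>S\<^sub>n\<close> is a function \<open>w :: nat \<Rightarrow> nat\<close> with \<open>w permutes {1..n}\<close>; it fixes
  every \<open>i > n\<close> (and the junk value \<open>0\<close>), so that it is at the same time a permutation of
  the positive integers.  Products are compositions, \<open>(u v)(i) = u (v i)\<close>.
\<close>

type_synonym perm = "nat \<Rightarrow> nat"

definition Sym :: "nat \<Rightarrow> perm set" where
  "Sym n = {w. w permutes {1..n}}"

abbreviation transp :: "nat \<Rightarrow> nat \<Rightarrow> perm" where
  "transp a b \<equiv> Transposition.transpose a b"

definition simple :: "nat \<Rightarrow> perm" where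
  "simple i = transp i (i + 1)"

definition w0 :: "nat \<Rightarrow> perm" where
  "w0 n = (\<lambda>i. if i \<in> {1..n} then n + 1 - i else i)"

definition len :: "perm \<Rightarrow> nat" where
  "len w = card {(i, j). 1 \<le> i \<and> i < j \<and> w i > w j}"

text \<open>
  Bruhat order, generated by length-increasing right multiplications by transpositions of
  positive integers.  Intermediate permutations are not required to lie in a fixed \<open>S\<^sub>n\<close>;
  between elements of \<open>S\<^sub>n\<close> this gives the Bruhat order of \<open>S\<^sub>n\<close>.
\<close>

inductive bruhat_le :: "perm \<Rightarrow> perm \<Rightarrow> bool" where
  refl: "bruhat_le v v"
| step: "\<lbrakk>bruhat_le u v; 1 \<le> a; a < b; len v < len (v \<circ> transp a b)\<rbrakk>
           \<Longrightarrow> bruhat_le u (v \<circ> transp a b)"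

definition demazure_step :: "perm \<Rightarrow> nat \<Rightarrow> perm" where
  "demazure_step v m = (if len (v \<circ> simple m) > len v then v \<circ> simple m else v)"

definition demazure :: "nat list \<Rightarrow> perm" where
  "demazure a = foldl demazure_step id a"

definition word_prod :: "nat list \<Rightarrow> perm" where
  "word_prod a = foldl (\<lambda>v m. v \<circ> simple m) id a"

definition reduced_word :: "nat list \<Rightarrow> bool" where
  "reduced_word a \<longleftrightarrow> len (word_prod a) = length a"

text \<open>
  Polynomials over the integers in \<open>x\<^sub>0, x\<^sub>1, x\<^sub>2, \<dots>\<close> (\<open>x\<^sub>0\<close> is never used), as finitely
  supported functions from exponent vectors to coefficients, with convolution product.
\<close>

type_synonym mpol = "(nat \<Rightarrow>\<^sub>0 nat) \<Rightarrow>\<^sub>0 int"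

definition X :: "nat \<Rightarrow> mpol" where
  "X i = Poly_Mapping.single (Poly_Mapping.single i 1) 1"

text \<open>
  Exchange of \<open>x\<^sub>i\<close> and \<open>x\<^sub>i\<^sub>+\<^sub>1\<close>: the coefficient of the exponent vector \<open>m\<close> in \<open>s\<^sub>i \<cdot> f\<close> is the
  coefficient in \<open>f\<close> of \<open>m\<close> with entries \<open>i\<close> and \<open>i + 1\<close> interchanged.
\<close>

definition swap_vars :: "nat \<Rightarrow> mpol \<Rightarrow> mpol" where
  "swap_vars i f = Poly_Mapping.map_key (Poly_Mapping.map_key (simple i)) f"

text \<open>The quotient \<open>(f - s\<^sub>i \<cdot> f) / (x\<^sub>i - x\<^sub>i\<^sub>+\<^sub>1)\<close>, which is again a polynomial.\<close>

definition div_diff :: "nat \<Rightarrow> mpol \<Rightarrow> mpol" where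
  "div_diff i f = (THE g. g * (X i - X (i + 1)) = f - swap_vars i f)"

definition staircase :: "nat \<Rightarrow> mpol" where
  "staircase n = (\<Prod>i\<in>{1..<n}. X i ^ (n - i))"

text \<open>
  The recursion goes down from \<open>w\<^sub>0\<close> through an arbitrary choice of descents; as the result
  does not depend on the choice, it determines exactly one polynomial for each \<open>w \<in> S\<^sub>n\<close>.
\<close>

inductive is_schubert :: "nat \<Rightarrow> perm \<Rightarrow> mpol \<Rightarrow> bool" for n where
  top: "is_schubert n (w0 n) (staircase n)"
| down: "\<lbrakk>is_schubert n w f; 1 \<le> i; i < n; w i > w (i + 1)\<rbrakk>
           \<Longrightarrow> is_schubert n (w \<circ> simple i) (div_diff i f)"

definition schubert :: "nat \<Rightarrow> perm \<Rightarrow> mpol" where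
  "schubert n w = (THE f. is_schubert n w f)"

inductive is_grothendieck :: "nat \<Rightarrow> int \<Rightarrow> perm \<Rightarrow> mpol \<Rightarrow> bool" for n \<beta> where
  top: "is_grothendieck n \<beta> (w0 n) (staircase n)"
| down: "\<lbrakk>is_grothendieck n \<beta> w f; 1 \<le> i; i < n; w i > w (i + 1)\<rbrakk>
           \<Longrightarrow> is_grothendieck n \<beta> (w \<circ> simple i)
                 (div_diff i ((1 + of_int \<beta> * X (i + 1)) * f))"

definition grothendieck_beta :: "nat \<Rightarrow> int \<Rightarrow> perm \<Rightarrow> mpol" where
  "grothendieck_beta n \<beta> w = (THE f. is_grothendieck n \<beta> w f)"

definition grothendieck :: "nat \<Rightarrow> perm \<Rightarrow> mpol" where
  "grothendieck n w = grothendieck_beta n (-1) w"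

definition rothe :: "perm \<Rightarrow> (nat \<times> nat) set" where
  "rothe w = {(i, j). 1 \<le> i \<and> 1 \<le> j \<and> j < w i \<and> i < inv w j}"

text \<open>The parts of a partition are \<open>\<mu> 1 \<ge> \<mu> 2 \<ge> \<dots>\<close>, eventually zero; \<open>\<mu> 0\<close> is irrelevant.\<close>

definition is_partition :: "(nat \<Rightarrow> nat) \<Rightarrow> bool" where
  "is_partition \<mu> \<longleftrightarrow> antimono_on {1..} \<mu> \<and> finite {i. 1 \<le> i \<and> \<mu> i \<noteq> 0}"

definition young :: "(nat \<Rightarrow> nat) \<Rightarrow> (nat \<times> nat) set" where
  "young \<mu> = {(i, j). 1 \<le> i \<and> 1 \<le> j \<and> j \<le> \<mu> i}"

definition dom_diagram :: "perm \<Rightarrow> (nat \<times> nat) set" where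
  "dom_diagram w = (GREATEST Y. (\<exists>\<mu>. is_partition \<mu> \<and> Y = young \<mu>) \<and> Y \<subseteq> rothe w)"

definition addable :: "(nat \<times> nat) set \<Rightarrow> nat \<Rightarrow> nat \<Rightarrow> bool" where
  "addable Y i j \<longleftrightarrow> 1 \<le> i \<and> 1 \<le> j \<and> (i, j) \<notin> Y
     \<and> (i > 1 \<longrightarrow> (i - 1, j) \<in> Y) \<and> (j > 1 \<longrightarrow> (i, j - 1) \<in> Y)"

definition alpha :: "nat \<Rightarrow> perm \<Rightarrow> nat" where
  "alpha n w = (LEAST j. \<exists>i. addable (dom_diagram w) i j \<and> i + j \<le> n)"

definition phi :: "nat \<Rightarrow> perm \<Rightarrow> nat set" where
  "phi i w = {a. a > i \<and> w a > w i \<and> \<not> (\<exists>a'. i < a' \<and> a' < a \<and> w i < w a' \<and> w a' < w a)}"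

definition Phi :: "nat \<Rightarrow> perm \<Rightarrow> perm set" where
  "Phi i w = {w \<circ> transp i a | a. a \<in> phi i w}"

text \<open>For \<open>A = {i\<^sub>1 < \<dots> < i\<^sub>k}\<close> the factors appear in the order \<open>i\<^sub>k, \<dots>, i\<^sub>1\<close>.\<close>

definition Phi_bar :: "nat \<Rightarrow> perm \<Rightarrow> perm set" where
  "Phi_bar i w = {foldl (\<lambda>v a. v \<circ> transp i a) w (rev (sorted_list_of_set A)) | A.
     finite A \<and> A \<noteq> {} \<and> A \<subseteq> phi i w}"

text \<open>An arc \<open>(w, (i, j), u)\<close> runs from \<open>w\<close> to \<open>u\<close> and has label \<open>(i, j)\<close>.\<close>

type_synonym arc = "perm \<times> (nat \<times> nat) \<times> perm"

definition graph_of :: "nat \<Rightarrow> (nat \<Rightarrow> perm \<Rightarrow> perm set) \<Rightarrow> (perm, arc) pre_digraph" where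
  "graph_of n T =
     \<lparr> verts = Sym n,
       arcs = {(w, (i, j), u) | w i j u.
                 w \<in> Sym n \<and> w \<noteq> w0 n \<and> j = alpha n w \<and> i = inv w j \<and> u \<in> T i w},
       tail = (\<lambda>(w, _, u). w),
       head = (\<lambda>(w, _, u). u) \<rparr>"

definition G_graph :: "nat \<Rightarrow> (perm, arc) pre_digraph" where
  "G_graph n = graph_of n Phi"

definition G_bar_graph :: "nat \<Rightarrow> (perm, arc) pre_digraph" where
  "G_bar_graph n = graph_of n Phi_bar"

definition R_graph :: "nat \<Rightarrow> (perm, arc) pre_digraph" where
  "R_graph n = graph_of n (\<lambda>i w. {u \<in> Phi_bar i w. bruhat_le (w \<circ> simple i) u})"

text \<open>A path is the list of its arcs.\<close>

definition paths :: "(perm, arc) pre_digraph \<Rightarrow> perm \<Rightarrow> perm \<Rightarrow> arc list set" where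
  "paths G u v = {p. pre_digraph.awalk G u p v}"

definition row_label :: "arc \<Rightarrow> nat" where
  "row_label = (\<lambda>(w, (i, j), u). i)"

definition path_word :: "arc list \<Rightarrow> nat list" where
  "path_word p = rev (map row_label p)"

definition path_wt :: "arc list \<Rightarrow> mpol" where
  "path_wt p = (\<Prod>e\<leftarrow>p. X (row_label e))"

definition reduced_path :: "arc list \<Rightarrow> bool" where
  "reduced_path p \<longleftrightarrow> reduced_word (path_word p)"

end

theory Submission
  imports Defs
begin

text \<open>
  Fix a parameter \<open>\<beta>\<close>, write \<open>G\<^sub>w\<close> for \<open>\<GG>\<^sub>w\<close> with this parameter, and put
  \<open>\<pi>\<^sub>i f = N\<^sub>i ((1 + \<beta> x\<^sub>i\<^sub>+\<^sub>1) f)\<close>; Schubert polynomials are the case \<open>\<beta> = 0\<close>.  Let \<open>j = \<alpha>(w)\<close> and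
  \<open>i = w\<inverse>(j)\<close>.  Everything rests on the co-transition formula
  \<open>x\<^sub>i G\<^sub>w = \<Sum>\<^sub>A \<beta>\<^bsup>|A|-1\<^esup> G\<^sub>u\<^sub>(\<^sub>A\<^sub>)\<close>, summed over the nonempty subsets \<open>A\<close> of \<open>\<phi>\<^sub>i(w)\<close>, where
  \<open>u(A)\<close> is the element of the set \<open>Phi_bar i w\<close> given by \<open>A\<close>.  With \<open>v = w s\<^sub>i\<close> the twisted Leibniz
  rule gives \<open>x\<^sub>i G\<^sub>w = \<pi>\<^sub>i(x\<^sub>i\<^sub>+\<^sub>1 G\<^sub>v) + (1 + \<beta> x\<^sub>i\<^sub>+\<^sub>1) G\<^sub>v\<close>, which reduces the formula for \<open>(w, i)\<close> to
  the one for \<open>(v, i + 1)\<close>, until the value \<open>j\<close> is one step away from its position in \<open>w\<^sub>0\<close>.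

  The first two expansions iterate this formula.  For the other two, \<open>w(i) < w(i + 1)\<close> makes \<open>G\<^sub>w\<close>
  symmetric in \<open>x\<^sub>i\<close> and \<open>x\<^sub>i\<^sub>+\<^sub>1\<close>, so that \<open>G\<^sub>w = \<pi>\<^sub>i(x\<^sub>i G\<^sub>w)\<close> even if the parameter of \<open>\<pi>\<^sub>i\<close> differs from
  that of \<open>G\<close>.  Each edge thus contributes one operator \<open>\<pi>\<^sub>i\<close>.  With parameter \<open>-1\<close> these operators
  act on the Grothendieck polynomials of the \<open>w\<^sub>0 v\<close> as the Demazure product acts on \<open>v\<close>; with
  parameter \<open>0\<close> they act on the Schubert polynomials of the \<open>w\<^sub>0 v\<close> as \<open>v \<mapsto> v s\<^sub>i\<close> when this increases
  the length and by \<open>0\<close> otherwise, so that only reduced words survive.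
\<close>

section \<open>Exchange of variables and divided differences\<close>

text \<open>Exchanging variables is additive, so its laws need checking only on single terms. The
  rule serves polynomials and exponent vectors alike, both being finitely supported
  functions.\<close>

lemma poly_mapping_induct_single [case_names zero single add]:
  fixes p :: "'a \<Rightarrow>\<^sub>0 'b::comm_monoid_add"
  assumes "P 0" and "\<And>k v. P (Poly_Mapping.single k v)" and "\<And>p q. P p \<Longrightarrow> P q \<Longrightarrow> P (p + q)"
  shows "P p"
proof (induction p rule: update_induct)
  case const
  show ?case using assms(1) by simp
next
  case (update f a b)
  have "Poly_Mapping.update a b f = f + Poly_Mapping.single a b"
    using update(1)
    by (intro poly_mapping_eqI)
       (auto simp: lookup_update lookup_add lookup_single in_keys_iff when_def)
  then show ?case using assms(2,3) update by simp
qed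

lemma map_key_single_inv:
  assumes "inj f" "f (g k) = k"
  shows "Poly_Mapping.map_key f (Poly_Mapping.single k v) = Poly_Mapping.single (g k) v"
  using map_key_single[OF assms(1), of "g k" v] assms(2) by simp

lemma simple_simple [simp]: "simple i (simple i a) = a"
  by (simp add: simple_def)

lemma inj_simple [simp]: "inj (simple i)"
  by (metis injI simple_simple)

definition swap_exps :: "nat \<Rightarrow> (nat \<Rightarrow>\<^sub>0 nat) \<Rightarrow> (nat \<Rightarrow>\<^sub>0 nat)" where
  "swap_exps i = Poly_Mapping.map_key (simple i)"

lemma swap_exps_swap_exps [simp]: "swap_exps i (swap_exps i m) = m"
proof -
  have "simple i \<circ> simple i = (\<lambda>x. x)" by auto
  then show ?thesis
    unfolding swap_exps_def by (simp add: map_key_compose map_key_id)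
qed

lemma inj_swap_exps [simp]: "inj (swap_exps i)"
  by (metis injI swap_exps_swap_exps)

lemma swap_exps_add: "swap_exps i (a + b) = swap_exps i a + swap_exps i b"
  unfolding swap_exps_def by (rule map_key_plus) simp

lemma swap_exps_0 [simp]: "swap_exps i 0 = 0"
  unfolding swap_exps_def by (rule map_key_zero) simp

lemma swap_exps_single: "swap_exps i (Poly_Mapping.single a v) = Poly_Mapping.single (simple i a) v"
  unfolding swap_exps_def by (rule map_key_single_inv) simp_all

lemma swap_vars_eq: "swap_vars i f = Poly_Mapping.map_key (swap_exps i) f"
  by (simp add: swap_vars_def swap_exps_def)

lemma swap_vars_single: "swap_vars i (Poly_Mapping.single m c) = Poly_Mapping.single (swap_exps i m) c"
  unfolding swap_vars_eq by (rule map_key_single_inv) simp_all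

lemma swap_vars_add [simp]: "swap_vars i (f + g) = swap_vars i f + swap_vars i g"
  unfolding swap_vars_eq by (rule map_key_plus) simp

lemma swap_vars_0 [simp]: "swap_vars i 0 = 0"
  unfolding swap_vars_eq by (rule map_key_zero) simp

lemma swap_vars_swap_vars [simp]: "swap_vars i (swap_vars i f) = f"
proof -
  have "swap_exps i \<circ> swap_exps i = (\<lambda>x. x)" by auto
  then show ?thesis
    unfolding swap_vars_eq by (simp add: map_key_compose map_key_id)
qed

lemma swap_vars_mult [simp]: "swap_vars i (f * g) = swap_vars i f * swap_vars i g"
proof (induction f rule: poly_mapping_induct_single)
  case (single m c)
  show ?case
  proof (induction g rule: poly_mapping_induct_single)
    case (single k v)
    then show ?case by (simp add: mult_single swap_vars_single swap_exps_add)
  qed (simp_all add: distrib_left)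
qed (simp_all add: distrib_right)

lemma swap_vars_uminus [simp]: "swap_vars i (- f) = - swap_vars i f"
  by (metis add.right_inverse add_eq_0_iff swap_vars_0 swap_vars_add)

lemma swap_vars_diff [simp]: "swap_vars i (f - g) = swap_vars i f - swap_vars i g"
  by (metis diff_conv_add_uminus swap_vars_add swap_vars_uminus)

lemma swap_vars_1 [simp]: "swap_vars i 1 = 1"
  using swap_vars_single[of i 0 1] by simp

lemma swap_vars_of_int [simp]: "swap_vars i (of_int c) = of_int c"
  using swap_vars_single[of i 0 c] unfolding swap_exps_0 by (metis of_int_eq_id id_apply single_of_int)

lemma swap_vars_X: "swap_vars i (X a) = X (simple i a)"
  by (simp add: X_def swap_vars_single swap_exps_single)

lemma simple_simps [simp]: "simple i i = Suc i" "simple i (Suc i) = i"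
  "a \<noteq> i \<Longrightarrow> a \<noteq> Suc i \<Longrightarrow> simple i a = a"
  by (simp_all add: simple_def)

lemma swap_vars_X_simps [simp]: "swap_vars i (X i) = X (Suc i)" "swap_vars i (X (Suc i)) = X i"
  "a \<noteq> i \<Longrightarrow> a \<noteq> Suc i \<Longrightarrow> swap_vars i (X a) = X a"
  by (simp_all add: swap_vars_X)

lemma swap_vars_prod: "swap_vars i (\<Prod>a\<in>A. f a) = (\<Prod>a\<in>A. swap_vars i (f a))"
  by (induction A rule: infinite_finite_induct) simp_all

lemma swap_vars_power [simp]: "swap_vars i (f ^ k) = swap_vars i f ^ k"
  by (induction k) simp_all

lemma swap_vars_map_comp:
  assumes "simple i \<circ> simple k = simple k' \<circ> simple i'"
  shows "swap_vars i (swap_vars k f) = swap_vars k' (swap_vars i' f)"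
proof (induction f rule: poly_mapping_induct_single)
  case (single m c)
  have "swap_exps i (swap_exps k m) = swap_exps k' (swap_exps i' m)"
  proof (induction m rule: poly_mapping_induct_single)
    case (single a v)
    show ?case using assms by (simp add: swap_exps_single fun_eq_iff)
  qed (simp_all add: swap_exps_add)
  then show ?case by (simp add: swap_vars_single)
qed simp_all

lemma simple_commute:
  assumes "i + 1 < k \<or> k + 1 < i"
  shows "simple i \<circ> simple k = simple k \<circ> simple i"
  using assms by (auto simp: fun_eq_iff simple_def Transposition.transpose_def)

lemma swap_vars_commute:
  "i + 1 < k \<or> k + 1 < i \<Longrightarrow> swap_vars i (swap_vars k f) = swap_vars k (swap_vars i f)"
  by (intro swap_vars_map_comp simple_commute)

lemma simple_braid: "simple i (simple (Suc i) (simple i a)) = simple (Suc i) (simple i (simple (Suc i) a))"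
  by (auto simp: simple_def Transposition.transpose_def)

lemma swap_vars_braid:
  "swap_vars i (swap_vars (Suc i) (swap_vars i f)) = swap_vars (Suc i) (swap_vars i (swap_vars (Suc i) f))"
proof (induction f rule: poly_mapping_induct_single)
  case (single m c)
  have "swap_exps i (swap_exps (Suc i) (swap_exps i m)) = swap_exps (Suc i) (swap_exps i (swap_exps (Suc i) m))"
    by (induction m rule: poly_mapping_induct_single)
       (simp_all add: swap_exps_add swap_exps_single simple_braid)
  then show ?case by (simp add: swap_vars_single)
qed simp_all

section \<open>Divided differences of polynomials\<close>

lemma X_eq_iff [simp]: "X a = X b \<longleftrightarrow> a = b"
  unfolding X_def by (metis (no_types) keys_single lookup_single_eq lookup_single_not_eq one_neq_zero singleton_inject)

lemma X_neq_0 [simp]: "X a \<noteq> 0"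
  unfolding X_def by (metis lookup_single_eq lookup_zero one_neq_zero)

lemma X_diff_neq_0: "X i - X (Suc i) \<noteq> 0"
  by simp

text \<open>Divisibility passes to sums directly and to products by a twisted Leibniz rule, so it
  climbs from variables through powers and monomials to all polynomials. It gives the definite
  description in \<open>div_diff\<close> something to denote.\<close>

lemma diff_swap_vars_divisible: "\<exists>g. g * (X i - X (Suc i)) = f - swap_vars i f"
proof (induction f rule: poly_mapping_induct_single)
  case (single m c)
  \<comment> \<open>With s the exchange, f g - s(f) s(g) = (f - s(f)) g + s(f) (g - s(g)).\<close>
  have mult: "\<exists>h. h * (X i - X (Suc i)) = f * g - swap_vars i (f * g)"
    if "h1 * (X i - X (Suc i)) = f - swap_vars i f" "h2 * (X i - X (Suc i)) = g - swap_vars i g"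
    for f g h1 h2
  proof -
    have "(h1 * g + swap_vars i f * h2) * (X i - X (Suc i)) =
      (h1 * (X i - X (Suc i))) * g + swap_vars i f * (h2 * (X i - X (Suc i)))"
      by (simp add: algebra_simps)
    also have "\<dots> = f * g - swap_vars i (f * g)"
      unfolding that by (simp add: algebra_simps)
    finally show ?thesis by blast
  qed
  have single_X: "\<exists>g. g * (X i - X (Suc i)) = X a - swap_vars i (X a)" for a
  proof -
    consider "a = i" | "a = Suc i" | "a \<noteq> i" "a \<noteq> Suc i" by blast
    then show ?thesis
    proof cases
      case 1
      then have "1 * (X i - X (Suc i)) = X a - swap_vars i (X a)" by simp
      then show ?thesis by blast
    next
      case 2
      then have "(-1) * (X i - X (Suc i)) = X a - swap_vars i (X a)" by simp
      then show ?thesis by blast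
    next
      case 3
      then have "0 * (X i - X (Suc i)) = X a - swap_vars i (X a)" by simp
      then show ?thesis by blast
    qed
  qed
  have X_pow: "Poly_Mapping.single (Poly_Mapping.single a v) 1 = X a ^ v" for a v
  proof (induction v)
    case (Suc v)
    have "Poly_Mapping.single a (Suc v) = Poly_Mapping.single a 1 + Poly_Mapping.single a v"
      by (simp flip: single_add)
    then have "Poly_Mapping.single (Poly_Mapping.single a (Suc v)) 1 =
      X a * Poly_Mapping.single (Poly_Mapping.single a v) 1"
      by (simp add: X_def mult_single)
    then show ?case by (simp add: Suc)
  qed simp
  have pow: "\<exists>g. g * (X i - X (Suc i)) = X a ^ v - swap_vars i (X a ^ v)" for a v
  proof (induction v)
    case 0
    have "0 * (X i - X (Suc i)) = X a ^ 0 - swap_vars i (X a ^ 0)" by simp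
    then show ?case by blast
  next
    case (Suc v)
    then show ?case using mult single_X[of a] unfolding power_Suc by blast
  qed
  have mon: "\<exists>g. g * (X i - X (Suc i)) =
      Poly_Mapping.single m 1 - swap_vars i (Poly_Mapping.single m 1)" for m
  proof (induction m rule: poly_mapping_induct_single)
    case zero
    have "0 * (X i - X (Suc i)) = Poly_Mapping.single 0 1 - swap_vars i (Poly_Mapping.single 0 1)"
      by simp
    then show ?case by blast
  next
    case (single a v)
    show ?case unfolding X_pow by (rule pow)
  next
    case (add p q)
    have "Poly_Mapping.single (p + q) (1::int) = Poly_Mapping.single p 1 * Poly_Mapping.single q 1"
      by (simp add: mult_single)
    with mult add show ?case by metis
  qed
  have c: "0 * (X i - X (Suc i)) = of_int c - swap_vars i (of_int c)" by simp
  have "Poly_Mapping.single m c = of_int c * Poly_Mapping.single m 1"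
    unfolding single_of_int[symmetric] mult_single by simp
  then show ?case using mult[OF c] mon[of m] by metis
next
  case (add p q)
  then obtain g h where "g * (X i - X (Suc i)) = p - swap_vars i p"
    "h * (X i - X (Suc i)) = q - swap_vars i q" by blast
  then have "(g + h) * (X i - X (Suc i)) = p + q - swap_vars i (p + q)"
    by (simp add: distrib_right)
  then show ?case by blast
next
  case zero
  have "0 * (X i - X (Suc i)) = 0 - swap_vars i 0" by simp
  then show ?case by blast
qed

text \<open>Cancellation in the integral domain of polynomials makes the quotient unique. Operator
  identities can thus be proved by multiplying them out by x_i - x_(i+1), the standard route to the
  rules below.\<close>

lemma div_diff_eqI:
  assumes "g * (X i - X (Suc i)) = f - swap_vars i f"
  shows "div_diff i f = g"
  unfolding div_diff_def
proof (rule the_equality)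
  show "g * (X i - X (i + 1)) = f - swap_vars i f" using assms by simp
  fix h assume "h * (X i - X (i + 1)) = f - swap_vars i f"
  then have "h * (X i - X (Suc i)) = g * (X i - X (Suc i))" using assms by simp
  then show "h = g" using X_diff_neq_0 mult_cancel_right by blast
qed

lemma div_diff_mult_X_diff: "div_diff i f * (X i - X (Suc i)) = f - swap_vars i f"
  using diff_swap_vars_divisible[of i f] div_diff_eqI by blast

lemma div_diff_add: "div_diff i (f + g) = div_diff i f + div_diff i g"
  by (rule div_diff_eqI) (simp add: distrib_right div_diff_mult_X_diff)

lemma div_diff_symmetric: "swap_vars i f = f \<Longrightarrow> div_diff i f = 0"
  by (rule div_diff_eqI) simp

lemma div_diff_sum: "div_diff i (\<Sum>a\<in>A. f a) = (\<Sum>a\<in>A. div_diff i (f a))"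
  by (induction A rule: infinite_finite_induct) (simp_all add: div_diff_add div_diff_symmetric)

lemma div_diff_mult_symmetric:
  assumes "swap_vars i g = g"
  shows "div_diff i (g * f) = g * div_diff i f"
proof (rule div_diff_eqI)
  have "g * div_diff i f * (X i - X (Suc i)) = g * (f - swap_vars i f)"
    unfolding mult.assoc div_diff_mult_X_diff ..
  then show "g * div_diff i f * (X i - X (Suc i)) = g * f - swap_vars i (g * f)"
    using assms by (simp add: right_diff_distrib)
qed

text \<open>Numerator and denominator both change sign under the exchange, so their quotient is
  symmetric.\<close>

lemma swap_vars_div_diff [simp]: "swap_vars i (div_diff i f) = div_diff i f"
proof -
  have "swap_vars i (div_diff i f) * (X i - X (Suc i)) =
    - swap_vars i (div_diff i f * (X i - X (Suc i)))"
    by (simp add: algebra_simps)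
  also have "\<dots> = div_diff i f * (X i - X (Suc i))"
    unfolding div_diff_mult_X_diff by simp
  finally show ?thesis using X_diff_neq_0 mult_cancel_right by blast
qed

lemma swap_vars_div_diff_commute:
  assumes "i + 1 < k \<or> k + 1 < i"
  shows "swap_vars k (div_diff i f) = div_diff i (swap_vars k f)"
proof (rule div_diff_eqI[symmetric])
  have "swap_vars k (div_diff i f) * (X i - X (Suc i)) =
    swap_vars k (div_diff i f * (X i - X (Suc i)))"
    using assms by auto
  also have "\<dots> = swap_vars k f - swap_vars i (swap_vars k f)"
    unfolding div_diff_mult_X_diff by (simp add: swap_vars_commute[OF assms])
  finally show "swap_vars k (div_diff i f) * (X i - X (Suc i)) =
    swap_vars k f - swap_vars i (swap_vars k f)" .
qed

section \<open>The isobaric divided differences with a parameter\<close>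

definition demazure_op :: "int \<Rightarrow> nat \<Rightarrow> mpol \<Rightarrow> mpol" where
  "demazure_op \<beta> i f = div_diff i ((1 + of_int \<beta> * X (Suc i)) * f)"

lemma demazure_op_mult_X_diff:
  "demazure_op \<beta> i f * (X i - X (Suc i)) =
     (1 + of_int \<beta> * X (Suc i)) * f - (1 + of_int \<beta> * X i) * swap_vars i f"
  unfolding demazure_op_def div_diff_mult_X_diff by simp

lemma swap_vars_demazure_op [simp]: "swap_vars i (demazure_op \<beta> i f) = demazure_op \<beta> i f"
  by (simp add: demazure_op_def)

lemma demazure_op_eqI:
  assumes "g * (X i - X (Suc i)) = (1 + of_int \<beta> * X (Suc i)) * f - (1 + of_int \<beta> * X i) * swap_vars i f"
  shows "demazure_op \<beta> i f = g"
  unfolding demazure_op_def by (rule div_diff_eqI) (simp add: assms)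

lemma demazure_op_add: "demazure_op \<beta> i (f + g) = demazure_op \<beta> i f + demazure_op \<beta> i g"
  by (simp add: demazure_op_def distrib_left div_diff_add)

lemma demazure_op_sum: "demazure_op \<beta> i (\<Sum>a\<in>A. f a) = (\<Sum>a\<in>A. demazure_op \<beta> i (f a))"
  by (simp add: demazure_op_def sum_distrib_left div_diff_sum)

text \<open>For symmetric f the numerator is f times (1 + \<beta> x_(i+1)) - (1 + \<beta> x_i),
  which is -\<beta> times x_i - x_(i+1).\<close>

lemma demazure_op_symmetric: "swap_vars i f = f \<Longrightarrow> demazure_op \<beta> i f = - of_int \<beta> * f"
  by (rule demazure_op_eqI) (simp add: algebra_simps)

lemma demazure_op_mult_symmetric:
  "swap_vars i g = g \<Longrightarrow> demazure_op \<beta> i (g * f) = g * demazure_op \<beta> i f"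
  unfolding demazure_op_def by (metis div_diff_mult_symmetric mult.left_commute)

text \<open>The \<beta>-terms of x_i (1 + \<beta> x_(i+1)) - x_(i+1) (1 + \<beta> x_i) cancel.
  Multiplication by x_i can thus be undone with any parameter, which later lets one family of
  polynomials be expanded with the operators of another.\<close>

lemma demazure_op_X_mult_symmetric:
  "swap_vars i f = f \<Longrightarrow> demazure_op \<beta> i (X i * f) = f"
  by (rule demazure_op_eqI) (simp add: algebra_simps)

text \<open>Twisted Leibniz rule N_i(g h) = N_i(g) h + s_i(g) N_i(h) for g = x_(i+1), where N_i(g) =
  -1 and s_i(g) = x_i.\<close>

lemma demazure_op_X_Suc_mult:
  "demazure_op \<beta> i (X (Suc i) * f) = X i * demazure_op \<beta> i f - (1 + of_int \<beta> * X (Suc i)) * f"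
proof (rule demazure_op_eqI)
  have "(X i * demazure_op \<beta> i f - (1 + of_int \<beta> * X (Suc i)) * f) * (X i - X (Suc i)) =
     X i * (demazure_op \<beta> i f * (X i - X (Suc i))) - (1 + of_int \<beta> * X (Suc i)) * f * (X i - X (Suc i))"
    by (simp add: algebra_simps)
  also have "\<dots> = (1 + of_int \<beta> * X (Suc i)) * (X (Suc i) * f) - (1 + of_int \<beta> * X i) * swap_vars i (X (Suc i) * f)"
    unfolding demazure_op_mult_X_diff by (simp add: algebra_simps)
  finally show "(X i * demazure_op \<beta> i f - (1 + of_int \<beta> * X (Suc i)) * f) * (X i - X (Suc i)) =
    (1 + of_int \<beta> * X (Suc i)) * (X (Suc i) * f) - (1 + of_int \<beta> * X i) * swap_vars i (X (Suc i) * f)" .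
qed

lemma swap_vars_demazure_op_commute:
  assumes "i + 1 < k \<or> k + 1 < i"
  shows "swap_vars k (demazure_op \<beta> i f) = demazure_op \<beta> i (swap_vars k f)"
  using assms unfolding demazure_op_def by (subst swap_vars_div_diff_commute) auto

text \<open>All coefficients in the defining equation of \<open>\<pi>\<^sub>i\<close> are symmetric
  in x_k and x_(k+1), so the equation can be pushed through \<open>\<pi>\<^sub>k\<close>.\<close>

lemma demazure_op_commute:
  assumes "i + 1 < k \<or> k + 1 < i"
  shows "demazure_op \<beta> i (demazure_op \<beta> k f) = demazure_op \<beta> k (demazure_op \<beta> i f)"
proof (rule demazure_op_eqI)
  let ?p = "demazure_op \<beta> k"
  have *: "?p (g * f) = g * ?p f" if "swap_vars k g = g" for g f
    using that by (rule demazure_op_mult_symmetric)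
  have neg: "?p (- f) = - ?p f" for f
    using *[of "-1" f] by simp
  have "?p (demazure_op \<beta> i f) * (X i - X (Suc i)) =
     ?p ((X i - X (Suc i)) * demazure_op \<beta> i f)"
    using assms by (subst *) (auto simp: mult.commute)
  also have "\<dots> = ?p ((1 + of_int \<beta> * X (Suc i)) * f + - ((1 + of_int \<beta> * X i) * swap_vars i f))"
    by (simp add: mult.commute demazure_op_mult_X_diff)
  also have "\<dots> = (1 + of_int \<beta> * X (Suc i)) * ?p f - (1 + of_int \<beta> * X i) * ?p (swap_vars i f)"
    unfolding demazure_op_add neg using assms by (subst (1 2) *) auto
  also have "?p (swap_vars i f) = swap_vars i (?p f)"
    using assms by (intro swap_vars_demazure_op_commute[symmetric]) auto
  finally show "?p (demazure_op \<beta> i f) * (X i - X (Suc i)) =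
    (1 + of_int \<beta> * X (Suc i)) * ?p f - (1 + of_int \<beta> * X i) * swap_vars i (?p f)" .
qed

text \<open>The surplus factor \<open>a - b\<close> on both sides spares a division; it is cancelled in the end.\<close>

lemma braid_relation_aux:
  fixes a b c \<beta> :: "'a :: comm_ring_1"
  defines "A \<equiv> 1 + \<beta> * a" and "B \<equiv> 1 + \<beta> * b" and "C \<equiv> 1 + \<beta> * c"
  assumes F: "F * (a - b) = B * f - A * sf"
    and tF: "tF * (a - c) = C * tf - A * tsf"
    and stF: "stF * (b - c) = C * stf - B * stsf"
    and G: "G * (b - c) = C * F - B * tF"
    and sG: "sG * (a - c) = C * F - A * stF"
    and H: "H * (a - b) = B * G - A * sG"
  shows "H * ((a - b) * (b - c) * (a - c)) * (a - b) =
    (B * C^2 * f - A * C^2 * sf - B^2 * C * tf + A * B^2 * tsf + A^2 * C * stf - A^2 * B * stsf) * (a - b)"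
proof -
  \<comment> \<open>\<open>F\<close> enters through both \<open>G\<close> and \<open>sG\<close>;
    this identity turns its total coefficient into a multiple of a - b.\<close>
  have K: "B * (a - c) - A * (b - c) = (a - b) * C"
    unfolding A_def B_def C_def by (simp add: algebra_simps)
  have "H * ((a - b) * (b - c) * (a - c)) * (a - b) = H * (a - b) * ((b - c) * (a - c) * (a - b))"
    by (simp only: ac_simps)
  also have "\<dots> = (B * (a - c) * (G * (b - c)) - A * (b - c) * (sG * (a - c))) * (a - b)"
    unfolding H by (simp add: algebra_simps)
  also have "\<dots> = C * (B * (a - c) - A * (b - c)) * (F * (a - b))
    - B^2 * (tF * (a - c)) * (a - b) + A^2 * (stF * (b - c)) * (a - b)"
    unfolding G sG by (simp add: algebra_simps power2_eq_square)
  also have "\<dots> = (B * C^2 * f - A * C^2 * sf - B^2 * C * tf + A * B^2 * tsf + A^2 * C * stf - A^2 * B * stsf) * (a - b)"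
    unfolding F tF stF K by (simp add: algebra_simps power2_eq_square)
  finally show ?thesis .
qed

text \<open>Both sides, multiplied by the nonzero product V of the three differences, become the
  same combination E of the six images of f under the group generated by s_i and s_(i+1). The
  longest element has two spellings, identified by the braid relation of the exchanges.\<close>

lemma demazure_op_braid:
  "demazure_op \<beta> i (demazure_op \<beta> (Suc i) (demazure_op \<beta> i f)) =
   demazure_op \<beta> (Suc i) (demazure_op \<beta> i (demazure_op \<beta> (Suc i) f))"
proof -
  define a b c where "a = X i" and "b = X (Suc i)" and "c = X (Suc (Suc i))"
  define \<b> :: mpol where "\<b> = of_int \<beta>"
  define s t where "s = swap_vars i" and "t = swap_vars (Suc i)"
  define P Q where "P = demazure_op \<beta> i" and "Q = demazure_op \<beta> (Suc i)"
  note defs = a_def b_def c_def \<b>_def s_def t_def P_def Q_def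
  have P: "P g * (a - b) = (1 + \<b> * b) * g - (1 + \<b> * a) * s g" for g
    unfolding defs by (rule demazure_op_mult_X_diff)
  have Q: "Q g * (b - c) = (1 + \<b> * c) * g - (1 + \<b> * b) * t g" for g
    unfolding defs by (rule demazure_op_mult_X_diff)
  have sP: "s (P g) = P g" and tQ: "t (Q g) = Q g" for g unfolding defs by simp_all
  have s_mult: "s (g * h) = s g * s h" "s (g - h) = s g - s h" "s (g + h) = s g + s h"
    "s 1 = 1" "s \<b> = \<b>" "s a = b" "s b = a" "s c = c" for g h
    unfolding defs by simp_all
  have t_mult: "t (g * h) = t g * t h" "t (g - h) = t g - t h" "t (g + h) = t g + t h"
    "t 1 = 1" "t \<b> = \<b>" "t a = a" "t b = c" "t c = b" for g h
    unfolding defs by simp_all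
  have inv: "s (s g) = g" "t (t g) = g" for g unfolding defs by simp_all
  have sts: "s (t (s g)) = t (s (t g))" for g unfolding defs by (rule swap_vars_braid)
  have tP: "t (P g) * (a - c) = (1 + \<b> * c) * t g - (1 + \<b> * a) * t (s g)" for g
    using arg_cong[OF P[of g], of t] unfolding s_mult t_mult .
  have sQ: "s (Q g) * (a - c) = (1 + \<b> * c) * s g - (1 + \<b> * a) * s (t g)" for g
    using arg_cong[OF Q[of g], of s] unfolding s_mult t_mult .
  have stP: "s (t (P g)) * (b - c) = (1 + \<b> * c) * s (t g) - (1 + \<b> * b) * s (t (s g))" for g
    using arg_cong[OF tP[of g], of s] unfolding s_mult t_mult .
  have tsQ: "t (s (Q g)) * (a - b) = (1 + \<b> * b) * t (s g) - (1 + \<b> * a) * t (s (t g))" for g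
    using arg_cong[OF sQ[of g], of t] unfolding s_mult t_mult .
  define V where "V = (a - b) * (b - c) * (a - c)"
  define E where "E = (1 + \<b> * b) * (1 + \<b> * c)^2 * f - (1 + \<b> * a) * (1 + \<b> * c)^2 * s f
    - (1 + \<b> * b)^2 * (1 + \<b> * c) * t f + (1 + \<b> * a) * (1 + \<b> * b)^2 * t (s f)
    + (1 + \<b> * a)^2 * (1 + \<b> * c) * s (t f) - (1 + \<b> * a)^2 * (1 + \<b> * b) * s (t (s f))"
  have ab: "a - b \<noteq> 0" and bc: "b - c \<noteq> 0" and "a - c \<noteq> 0" unfolding defs by simp_all
  then have V: "V \<noteq> 0" unfolding V_def by simp
  have 1: "P (Q (P f)) * V * (a - b) = E * (a - b)"
    unfolding V_def E_def
    by (rule braid_relation_aux[OF P tP stP Q sQ[of "P f", unfolded sP] P])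
  have "Q (P (Q f)) * V * (b - c) = E * (b - c)"
  proof -
    let ?A = "1 + \<b> * a" and ?B = "1 + \<b> * b" and ?C = "1 + \<b> * c"
    have K: "?B * (a - c) - ?C * (a - b) = ?A * (b - c)" by (simp add: algebra_simps power2_eq_square)
    have "Q (P (Q f)) * V * (b - c) =
      (a - b) * (a - c) * (b - c) * (Q (P (Q f)) * (b - c))"
      unfolding V_def by (simp add: algebra_simps power2_eq_square)
    also have "\<dots> = ?C * (a - c) * (b - c) * (P (Q f) * (a - b))
        - ?B * (a - b) * (b - c) * (t (P (Q f)) * (a - c))"
      unfolding Q by (simp add: algebra_simps power2_eq_square)
    also have "\<dots> = ?C * (a - c) * (?B * (Q f * (b - c))) - ?C * (b - c) * ?A * (s (Q f) * (a - c))
        - ?B * (a - b) * ?C * (Q f * (b - c)) + ?B * (b - c) * ?A * (t (s (Q f)) * (a - b))"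
      unfolding P[of "Q f"] tP[of "Q f", unfolded tQ] by (simp add: algebra_simps power2_eq_square)
    also have "\<dots> = ?B * ?C * (b - c) * (Q f * (b - c)) - ?C * (b - c) * ?A * (s (Q f) * (a - c))
         + ?B * (b - c) * ?A * (t (s (Q f)) * (a - b))"
      by (simp add: algebra_simps power2_eq_square)
    also have "\<dots> = E * (b - c)"
      unfolding Q sQ tsQ E_def sts by (simp add: algebra_simps power2_eq_square)
    finally show ?thesis .
  qed
  with 1 ab bc V have "P (Q (P f)) = Q (P (Q f))" by (metis mult_cancel_right)
  then show ?thesis unfolding P_def Q_def .
qed

section \<open>Permutations\<close>

lemma Sym_imp_inj: "w \<in> Sym n \<Longrightarrow> inj w"
  unfolding Sym_def by (auto intro: permutes_inj)

lemma Sym_inj: "w \<in> Sym n \<Longrightarrow> w a = w b \<longleftrightarrow> a = b"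
  unfolding Sym_def by (auto dest: permutes_inj injD)

lemma Sym_range: "w \<in> Sym n \<Longrightarrow> 1 \<le> a \<Longrightarrow> a \<le> n \<Longrightarrow> 1 \<le> w a \<and> w a \<le> n"
  unfolding Sym_def using permutes_in_image[of w "{1..n}" a] by auto

lemma Sym_outside: "w \<in> Sym n \<Longrightarrow> a > n \<Longrightarrow> w a = a"
  unfolding Sym_def by (auto simp: permutes_def)

lemma Sym_inv: "w \<in> Sym n \<Longrightarrow> w (inv w a) = a"
  unfolding Sym_def using permutes_inverses(1) by fastforce

lemma Sym_inv_range: "w \<in> Sym n \<Longrightarrow> 1 \<le> a \<Longrightarrow> a \<le> n \<Longrightarrow> 1 \<le> inv w a \<and> inv w a \<le> n"
  unfolding Sym_def using permutes_in_image[OF permutes_inv, of w "{1..n}" a] by auto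

lemma Sym_inv_eq: "w \<in> Sym n \<Longrightarrow> inv w a = b \<longleftrightarrow> w b = a"
  by (metis Sym_inj Sym_inv)

lemma Sym_comp: "v \<in> Sym n \<Longrightarrow> w \<in> Sym n \<Longrightarrow> v \<circ> w \<in> Sym n"
  unfolding Sym_def by (auto intro: permutes_compose)

lemma transp_in_Sym: "1 \<le> a \<Longrightarrow> a \<le> n \<Longrightarrow> 1 \<le> b \<Longrightarrow> b \<le> n \<Longrightarrow> transp a b \<in> Sym n"
  unfolding Sym_def by (auto intro: permutes_swap_id)

lemma simple_in_Sym: "1 \<le> i \<Longrightarrow> i < n \<Longrightarrow> simple i \<in> Sym n"
  unfolding simple_def by (intro transp_in_Sym) auto

lemma id_in_Sym: "id \<in> Sym n"
  unfolding Sym_def by (simp add: permutes_id)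

lemma w0_in_Sym: "w0 n \<in> Sym n"
proof -
  have "bij_betw (w0 n) {1..n} {1..n}"
    by (rule bij_betw_byWitness[where f' = "w0 n"]) (auto simp: w0_def)
  then show ?thesis
    unfolding Sym_def by (auto intro!: bij_imp_permutes simp: w0_def)
qed

lemma comp_simple_simple: "w \<circ> simple k \<circ> simple k = w"
  by (simp add: fun_eq_iff)

text \<open>A substitute for the number of non-inversions; only its strict decrease matters.\<close>

definition weight :: "nat \<Rightarrow> perm \<Rightarrow> nat" where
  "weight n w = (\<Sum>a\<in>{1..n}. a * w a)"

lemma weight_transp_less:
  assumes "1 \<le> a" "a < b" "b \<le> n" "w a < w b"
  shows "weight n (w \<circ> transp a b) < weight n w"
proof -
  let ?R = "{1..n} - {a} - {b}"
  have split: "weight n v = a * v a + (b * v b + (\<Sum>c\<in>?R. c * v c))" for v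
    unfolding weight_def using assms
    by (subst sum.remove[of _ a], simp, simp, subst sum.remove[of _ b]) auto
  have rest: "(\<Sum>c\<in>?R. c * (w \<circ> transp a b) c) = (\<Sum>c\<in>?R. c * w c)"
    by (rule sum.cong) auto
  obtain d e where "b = a + d" "w b = w a + e" "d > 0" "e > 0"
    using assms by (metis less_imp_add_positive)
  then have "a * w b + b * w a < a * w a + b * w b"
    by (simp add: algebra_simps)
  then show ?thesis unfolding split rest by simp
qed

lemma weight_simple_less:
  "1 \<le> k \<Longrightarrow> k < n \<Longrightarrow> w k < w (Suc k) \<Longrightarrow> weight n (w \<circ> simple k) < weight n w"
  unfolding simple_def using weight_transp_less[of k "k + 1"] by simp

lemma decreasing_on:
  fixes w :: perm
  assumes "\<And>k. 1 \<le> k \<Longrightarrow> k < l \<Longrightarrow> w (Suc k) < w k" "1 \<le> p" "p < q" "q \<le> l"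
  shows "w q < w p"
  using assms(3,4)
proof (induction q)
  case (Suc q)
  have step: "w (Suc q) < w q" using Suc.prems assms(1)[of q] assms(2) by simp
  show ?case
  proof (cases "p = q")
    case False
    then show ?thesis using Suc step by simp
  qed (use step in simp)
qed simp

lemma not_ascent: "w \<in> Sym n \<Longrightarrow> \<not> w k < w (Suc k) \<longleftrightarrow> w (Suc k) < w k"
  using Sym_inj[of w n k "Suc k"] by auto

text \<open>The positions after l hold the values 1 to n - l, so the first l positions share the
  values from n + 1 - l upwards, and the smallest of these sits at l.\<close>

lemma minimal_prefix_value:
  assumes w: "w \<in> Sym n" and l: "1 \<le> l" "l \<le> n"
    and above: "\<And>p. l < p \<Longrightarrow> p \<le> n \<Longrightarrow> w p = n + 1 - p"
    and min: "\<And>p. 1 \<le> p \<Longrightarrow> p < l \<Longrightarrow> w l < w p"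
  shows "w l = n + 1 - l"
proof -
  define q where "q = inv w (n + 1 - l)"
  have wq: "w q = n + 1 - l" and q: "1 \<le> q" "q \<le> n"
    unfolding q_def using w l Sym_inv Sym_inv_range[of w n "n + 1 - l"] by auto
  have "q \<le> l" using above[of q] wq q l by (cases "l < q") auto
  moreover have False if "q < l"
  proof -
    have "w l < n + 1 - l" using min[of q] wq q that by simp
    moreover have "1 \<le> w l" using Sym_range[OF w l] by simp
    ultimately have "l < n + 1 - w l" "n + 1 - w l \<le> n" "w (n + 1 - w l) = w l"
      using above[of "n + 1 - w l"] l by auto
    then show False using Sym_inj[OF w] by (metis less_irrefl)
  qed
  ultimately show ?thesis using wq by (metis le_neq_implies_less)
qed

lemma decreasing_imp_w0:
  assumes w: "w \<in> Sym n" and dec: "\<And>k. 1 \<le> k \<Longrightarrow> k < n \<Longrightarrow> w (Suc k) < w k"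
  shows "w = w0 n"
proof -
  have "\<forall>p. n - d < p \<and> p \<le> n \<longrightarrow> w p = n + 1 - p" for d
  proof (induction d)
    case (Suc d)
    show ?case
    proof (cases "d < n")
      case True
      have "w (n - d) = n + 1 - (n - d)"
      proof (rule minimal_prefix_value[OF w])
        show "w p = n + 1 - p" if "n - d < p" "p \<le> n" for p using Suc that by blast
        show "w (n - d) < w p" if "1 \<le> p" "p < n - d" for p
          by (rule decreasing_on[of n w, OF dec that]) auto
      qed (use True in auto)
      moreover have "p = n - d \<or> n - d < p" if "n - Suc d < p" for p
        using that True by linarith
      ultimately show ?thesis using Suc by blast
    qed (use Suc in auto)
  qed auto
  from this[of n] have "w p = w0 n p" for p
    using w by (cases "p \<in> {1..n}") (auto simp: w0_def Sym_def permutes_def)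
  then show ?thesis by blast
qed

lemma exists_ascent:
  assumes "w \<in> Sym n" "w \<noteq> w0 n"
  obtains k where "1 \<le> k" "k < n" "w k < w (Suc k)"
  using decreasing_imp_w0[OF assms(1)] not_ascent[OF assms(1)] assms(2) by blast

lemma w0_less_iff:
  assumes "1 \<le> a" "a \<le> n" "1 \<le> b" "b \<le> n"
  shows "w0 n a < w0 n b \<longleftrightarrow> b < a"
  using assms by (auto simp: w0_def)

section \<open>Grothendieck polynomials are well defined\<close>

lemma is_grothendieck_in_Sym: "is_grothendieck n \<beta> w f \<Longrightarrow> w \<in> Sym n"
  by (induction rule: is_grothendieck.induct) (intro w0_in_Sym Sym_comp simple_in_Sym; assumption)+

lemma is_grothendieck_ascent:
  assumes "is_grothendieck n \<beta> (w \<circ> simple k) g" "1 \<le> k" "k < n" "w k < w (Suc k)"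
  shows "is_grothendieck n \<beta> w (demazure_op \<beta> k g)"
  using is_grothendieck.down[OF assms(1-3)] assms(4)
  by (simp add: demazure_op_def comp_simple_simple)

lemma is_grothendieck_cases:
  assumes "is_grothendieck n \<beta> w f"
  obtains "w = w0 n" "f = staircase n"
  | k g where "1 \<le> k" "k < n" "w k < w (Suc k)" "is_grothendieck n \<beta> (w \<circ> simple k) g"
      "f = demazure_op \<beta> k g"
  using assms
proof cases
  case (down v g k)
  show thesis
    by (rule that(2)[of k g]) (use down in \<open>simp_all add: comp_simple_simple demazure_op_def\<close>)
qed (use that in blast)

lemma is_grothendieck_exists: "w \<in> Sym n \<Longrightarrow> \<exists>f. is_grothendieck n \<beta> w f"
proof (induction "weight n w" arbitrary: w rule: less_induct)
  case less
  show ?case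
  proof (cases "w = w0 n")
    case False
    then obtain k where k: "1 \<le> k" "k < n" "w k < w (Suc k)"
      using exists_ascent less.prems by blast
    then obtain g where "is_grothendieck n \<beta> (w \<circ> simple k) g"
      using less.hyps[OF weight_simple_less[of k n w]] less.prems by (blast intro: Sym_comp simple_in_Sym)
    then show ?thesis using k is_grothendieck_ascent by blast
  qed (auto intro: is_grothendieck.top)
qed

lemma w0_descent: "1 \<le> k \<Longrightarrow> k < n \<Longrightarrow> \<not> w0 n k < w0 n (Suc k)"
  by (auto simp: w0_def)

text \<open>A diamond argument by induction on the weight. Two ascents k and l of w lead on to a
  common permutation, w s_k s_l if they are far apart and w s_k s_l s_k if adjacent. A polynomial
  there determines both intermediate ones by induction, and commutation or the braid relation makes
  the results agree.\<close>

lemma is_grothendieck_unique: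
  "is_grothendieck n \<beta> w f \<Longrightarrow> is_grothendieck n \<beta> w f' \<Longrightarrow> f = f'"
proof (induction "weight n w" arbitrary: w f f' rule: less_induct)
  case less
  note w = is_grothendieck_in_Sym[OF less.prems(1)]
  have IH: "g = g'" if "is_grothendieck n \<beta> (w \<circ> simple k) g" "is_grothendieck n \<beta> (w \<circ> simple k) g'"
      "1 \<le> k" "k < n" "w k < w (Suc k)" for k g g'
    using less.hyps[OF weight_simple_less[OF that(3-5)] that(1,2)] .
  have far: "demazure_op \<beta> k g = demazure_op \<beta> l g'"
    if k: "1 \<le> k" "k < n" "w k < w (Suc k)" "is_grothendieck n \<beta> (w \<circ> simple k) g"
    and l: "1 \<le> l" "l < n" "w l < w (Suc l)" "is_grothendieck n \<beta> (w \<circ> simple l) g'"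
    and kl: "k + 1 < l" for k l g g'
  proof -
    let ?v = "w \<circ> simple k \<circ> simple l"
    have v: "?v = w \<circ> simple l \<circ> simple k"
      using kl by (simp add: comp_assoc simple_commute)
    have "?v \<in> Sym n" using w k(1,2) l(1,2) by (intro Sym_comp simple_in_Sym)
    then obtain h where h: "is_grothendieck n \<beta> ?v h" using is_grothendieck_exists by blast
    have "is_grothendieck n \<beta> (w \<circ> simple k) (demazure_op \<beta> l h)"
      using h l kl by (intro is_grothendieck_ascent) auto
    moreover have "is_grothendieck n \<beta> (w \<circ> simple l) (demazure_op \<beta> k h)"
      using h[unfolded v] k kl by (intro is_grothendieck_ascent) auto
    ultimately have "g = demazure_op \<beta> l h" "g' = demazure_op \<beta> k h"
      using IH k l by blast+
    then show ?thesis using kl by (simp add: demazure_op_commute)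
  qed
  have near: "demazure_op \<beta> k g = demazure_op \<beta> (Suc k) g'"
    if k: "1 \<le> k" "k < n" "w k < w (Suc k)" "is_grothendieck n \<beta> (w \<circ> simple k) g"
    and l: "Suc k < n" "w (Suc k) < w (Suc (Suc k))" "is_grothendieck n \<beta> (w \<circ> simple (Suc k)) g'"
    for k g g'
  proof -
    let ?s = "simple k" and ?t = "simple (Suc k)"
    let ?v = "w \<circ> ?s \<circ> ?t \<circ> ?s"
    have v: "?v = w \<circ> ?t \<circ> ?s \<circ> ?t"
      by (simp add: fun_eq_iff simple_braid)
    have "?v \<in> Sym n" using w k(1,2) l(1) by (intro Sym_comp simple_in_Sym) auto
    then obtain h where h: "is_grothendieck n \<beta> ?v h" using is_grothendieck_exists by blast
    have "is_grothendieck n \<beta> (w \<circ> ?s) (demazure_op \<beta> (Suc k) (demazure_op \<beta> k h))"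
      using h k l by (intro is_grothendieck_ascent) auto
    moreover have "is_grothendieck n \<beta> (w \<circ> ?t) (demazure_op \<beta> k (demazure_op \<beta> (Suc k) h))"
      using h[unfolded v] k l by (intro is_grothendieck_ascent) auto
    ultimately have "g = demazure_op \<beta> (Suc k) (demazure_op \<beta> k h)"
      "g' = demazure_op \<beta> k (demazure_op \<beta> (Suc k) h)"
      using IH[OF k(4) _ k(1-3)] IH[OF l(3) _ _ l(1,2)] by auto
    then show ?thesis by (simp add: demazure_op_braid)
  qed
  show ?case
  proof (cases rule: is_grothendieck_cases[OF less.prems(1)])
    case 1
    show ?thesis
      by (cases rule: is_grothendieck_cases[OF less.prems(2)]) (use 1 w0_descent in auto)
  next
    case (2 k g)
    note k = this
    show ?thesis
    proof (cases rule: is_grothendieck_cases[OF less.prems(2)])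
      case 1
      then show ?thesis using 2 w0_descent by auto
    next
      case (2 l g')
      note l = this
      consider "k = l" | "k + 1 < l" | "l + 1 < k" | "l = Suc k" | "k = Suc l" by linarith
      then show ?thesis
      proof cases
        assume "k = l"
        then show ?thesis using IH[of k g g'] k l by simp
      next
        assume "k + 1 < l"
        then show ?thesis unfolding k(5) l(5) by (intro far k(1-4) l(1-4))
      next
        assume "l + 1 < k"
        then show ?thesis unfolding k(5) l(5) by (intro far[symmetric] k(1-4) l(1-4))
      next
        assume "l = Suc k"
        then show ?thesis using near[OF k(1-4)] k(5) l by simp
      next
        assume "k = Suc l"
        then show ?thesis using near[OF l(1-4)] l(5) k by simp
      qed
    qed
  qed
qed

lemma grothendieck_beta_eqI: "is_grothendieck n \<beta> w f \<Longrightarrow> grothendieck_beta n \<beta> w = f"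
  unfolding grothendieck_beta_def by (intro the_equality) (auto intro: is_grothendieck_unique)

lemma grothendieck_beta_w0: "grothendieck_beta n \<beta> (w0 n) = staircase n"
  by (intro grothendieck_beta_eqI is_grothendieck.top)

lemma is_grothendieck_grothendieck_beta: 
  "w \<in> Sym n \<Longrightarrow> is_grothendieck n \<beta> w (grothendieck_beta n \<beta> w)"
  using is_grothendieck_exists grothendieck_beta_eqI by metis

lemma grothendieck_beta_ascent:
  assumes "w \<in> Sym n" "1 \<le> k" "k < n" "w k < w (Suc k)"
  shows "grothendieck_beta n \<beta> w = demazure_op \<beta> k (grothendieck_beta n \<beta> (w \<circ> simple k))"
  using assms
  by (intro grothendieck_beta_eqI is_grothendieck_ascent is_grothendieck_grothendieck_beta Sym_comp simple_in_Sym)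

text \<open>A descent is the defining recursion. At an ascent G_w is itself an image of
  \<open>\<pi>\<^sub>k\<close>, hence symmetric, and is only rescaled.\<close>

lemma demazure_op_grothendieck_beta:
  assumes w: "w \<in> Sym n" and k: "1 \<le> k" "k < n"
  shows "demazure_op \<beta> k (grothendieck_beta n \<beta> w) =
    (if w (Suc k) < w k then grothendieck_beta n \<beta> (w \<circ> simple k)
     else - of_int \<beta> * grothendieck_beta n \<beta> w)"
proof (cases "w (Suc k) < w k")
  case True
  then show ?thesis
    using grothendieck_beta_ascent[of "w \<circ> simple k" n k \<beta>] assms
    by (simp add: Sym_comp simple_in_Sym comp_simple_simple)
next
  case False
  then have "w k < w (Suc k)" using not_ascent[OF w] by blast
  then show ?thesis
    using grothendieck_beta_ascent[OF w k] by (simp add: demazure_op_symmetric)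
qed

lemma swap_vars_grothendieck_beta:
  assumes "w \<in> Sym n" "1 \<le> k" "k < n" "w k < w (Suc k)"
  shows "swap_vars k (grothendieck_beta n \<beta> w) = grothendieck_beta n \<beta> w"
  unfolding grothendieck_beta_ascent[OF assms] by simp

lemma schubert_eq_grothendieck_beta: "schubert n w = grothendieck_beta n 0 w"
proof -
  have "is_schubert n w f \<longleftrightarrow> is_grothendieck n 0 w f" for w f
  proof
    assume "is_schubert n w f"
    then show "is_grothendieck n 0 w f"
    proof induction
      case (down w f i)
      then show ?case using is_grothendieck.down[of n 0 w f i] by (simp add: comp_def)
    qed (rule is_grothendieck.top)
  next
    assume "is_grothendieck n 0 w f"
    then show "is_schubert n w f"
    proof induction
      case (down w f i)
      then show ?case using is_schubert.down[of n w f i] by (simp add: comp_def)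
    qed (rule is_schubert.top)
  qed
  then have "is_schubert n w = is_grothendieck n 0 w" by (intro ext)
  then show ?thesis unfolding schubert_def grothendieck_beta_def by simp
qed

section \<open>Length and Bruhat order\<close>

definition inversions :: "perm \<Rightarrow> (nat \<times> nat) set" where
  "inversions v = {(p, q). 1 \<le> p \<and> p < q \<and> v p > v q}"

lemma len_eq_card_inversions: "len v = card (inversions v)"
  by (simp add: len_def inversions_def)

lemma finite_inversions:
  assumes "v \<in> Sym n"
  shows "finite (inversions v)"
proof (rule finite_subset)
  show "inversions v \<subseteq> {1..n} \<times> {1..n}"
  proof clarify
    fix p q assume "(p, q) \<in> inversions v"
    then have pq: "1 \<le> p" "p < q" "v q < v p" by (auto simp: inversions_def)
    have "q \<le> n"
    proof (rule ccontr)
      assume "\<not> q \<le> n"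
      then have "v q = q" using Sym_outside[OF assms] by simp
      moreover have "v p \<le> max n p"
        using Sym_range[OF assms pq(1)] Sym_outside[OF assms, of p] by (cases "p \<le> n") auto
      ultimately show False using \<open>\<not> q \<le> n\<close> pq by linarith
    qed
    then show "p \<in> {1..n} \<and> q \<in> {1..n}" using pq by auto
  qed
qed simp

text \<open>The inversions of v inject into those of the product, and the injection misses the pair
  (a, b).\<close>

lemma len_transp_less:
  assumes v: "v \<in> Sym n" and ab: "1 \<le> a" "a < b" "b \<le> n" "v a < v b"
  shows "len v < len (v \<circ> transp a b)"
proof -
  let ?t = "transp a b"
  have Sym: "v \<circ> ?t \<in> Sym n"
    using v ab by (intro Sym_comp transp_in_Sym) auto
  \<comment> \<open>A pair is carried along by the transposition unless that would reverse its
    order, in which case it stays put. To hit (a, b), it would have to come from (b, a) or from an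
    inversion of v at (a, b).\<close>
  define F where "F = (\<lambda>(p, q). if ?t p < ?t q then (?t p, ?t q) else (p, q))"
  have "inj_on F (inversions v)"
  proof (rule inj_onI, clarify)
    fix p q p' q' assume "(p, q) \<in> inversions v" "(p', q') \<in> inversions v" and F: "F (p, q) = F (p', q')"
    then have "p < q" "p' < q'" by (auto simp: inversions_def)
    moreover have "?t x = ?t y \<longleftrightarrow> x = y" for x y by (metis transpose_involutory)
    ultimately show "p = p' \<and> q = q'"
      using F unfolding F_def by (cases "?t p < ?t q"; cases "?t p' < ?t q'") auto
  qed
  moreover have "F ` inversions v \<subseteq> inversions (v \<circ> ?t) - {(a, b)}"
    unfolding F_def inversions_def using ab
    by (auto simp: Transposition.transpose_def split: if_splits)
  ultimately have "len v \<le> card (inversions (v \<circ> ?t) - {(a, b)})"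
    unfolding len_eq_card_inversions using finite_inversions[OF Sym]
    by (metis card_inj_on_le finite_Diff)
  moreover have "(a, b) \<in> inversions (v \<circ> ?t)"
    using ab by (simp add: inversions_def)
  ultimately show ?thesis
    unfolding len_eq_card_inversions using finite_inversions[OF Sym]
    by (metis card_Diff1_less order.strict_trans1)
qed

text \<open>\<open>simple m\<close> preserves the order of every pair of positions but (m, m + 1),
  so it carries the old inversions along and adds just this one.\<close>

lemma len_simple_ascent:
  assumes v: "v \<in> Sym n" and m: "1 \<le> m" "v m < v (Suc m)"
  shows "len (v \<circ> simple m) = Suc (len v)"
proof -
  let ?s = "map_prod (simple m) (simple m)"
  have mono: "simple m p < simple m q" if "p < q" "(p, q) \<noteq> (m, Suc m)" for p q
    using that by (auto simp: simple_def Transposition.transpose_def)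
  have pos: "1 \<le> simple m p" if "1 \<le> p" for p
    using that m by (auto simp: simple_def Transposition.transpose_def)
  have "inversions (v \<circ> simple m) = insert (m, Suc m) (?s ` inversions v)"
  proof (intro equalityI subsetI)
    fix x assume "x \<in> inversions (v \<circ> simple m)"
    then obtain p q where x: "x = (p, q)" "1 \<le> p" "p < q" "v (simple m q) < v (simple m p)"
      by (auto simp: inversions_def)
    show "x \<in> insert (m, Suc m) (?s ` inversions v)"
    proof (cases "(p, q) = (m, Suc m)")
      case False
      then have "(simple m p, simple m q) \<in> inversions v"
        using x mono pos by (simp add: inversions_def)
      then have "?s (simple m p, simple m q) \<in> ?s ` inversions v" by (rule imageI)
      then show ?thesis using x by simp
    qed (use x in simp)
  next
    fix x assume "x \<in> insert (m, Suc m) (?s ` inversions v)"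
    then consider "x = (m, Suc m)"
      | p q where "x = (simple m p, simple m q)" "1 \<le> p" "p < q" "v q < v p"
      by (auto simp: inversions_def)
    then show "x \<in> inversions (v \<circ> simple m)"
    proof cases
      case 2
      then have "(p, q) \<noteq> (m, Suc m)" using m by auto
      then show ?thesis using 2 mono pos by (simp add: inversions_def)
    qed (use m in \<open>simp add: inversions_def\<close>)
  qed
  moreover have "(m, Suc m) \<notin> ?s ` inversions v"
    by (auto simp: inversions_def simple_def Transposition.transpose_def split: if_splits)
  moreover have "inj ?s" by (simp add: prod.inj_map)
  ultimately show ?thesis
    unfolding len_eq_card_inversions using finite_inversions[OF v]
    by (simp add: card_image inj_on_subset)
qed

lemma len_simple_less_iff:
  assumes v: "v \<in> Sym n" and m: "1 \<le> m" "m < n"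
  shows "len v < len (v \<circ> simple m) \<longleftrightarrow> v m < v (Suc m)"
proof (cases "v m < v (Suc m)")
  case False
  then have "v (Suc m) < v m" using not_ascent[OF v] by blast
  then have "len v = Suc (len (v \<circ> simple m))"
    using len_simple_ascent[of "v \<circ> simple m" n m] v m
    by (simp add: Sym_comp simple_in_Sym comp_simple_simple)
  then show ?thesis using False by simp
qed (use assms len_simple_ascent in simp)

lemma len_simple_le:
  assumes v: "v \<in> Sym n" and m: "1 \<le> m" "m < n"
  shows "len (v \<circ> simple m) \<le> Suc (len v)"
  using len_simple_less_iff[OF assms] len_simple_ascent[OF v m(1)] by (metis le_SucI not_less order_refl)

section \<open>The permutations reached along an edge\<close>

text \<open>For finite nonempty A avoiding i this is a cyclic shift of values: i receives the value
  at \<open>Min A\<close>, each element of A that of the next larger one, and \<open>Max A\<close>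
  the value w i.\<close>

definition rot :: "nat \<Rightarrow> perm \<Rightarrow> nat set \<Rightarrow> perm" where
  "rot i w A = foldl (\<lambda>v a. v \<circ> transp i a) w (rev (sorted_list_of_set A))"

lemma rot_empty [simp]: "rot i w {} = w"
  by (simp add: rot_def)

lemma rot_insert_min:
  assumes "finite A" "\<forall>a\<in>A. b < a"
  shows "rot i w (insert b A) = rot i w A \<circ> transp i b"
proof -
  have "b \<notin> A" using assms by auto
  then have "sorted_list_of_set (insert b A) = b # sorted_list_of_set A"
    using assms by (simp add: insort_is_Cons less_imp_le)
  then show ?thesis by (simp add: rot_def)
qed

lemma rot_singleton [simp]: "rot i w {a} = w \<circ> transp i a"
  using rot_insert_min[of "{}"] by simp

lemma rot_outside: "finite A \<Longrightarrow> a \<notin> A \<Longrightarrow> a \<noteq> i \<Longrightarrow> rot i w A a = w a"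
  by (induction A rule: finite_linorder_min_induct) (auto simp: rot_insert_min)

lemma rot_at:
  assumes "finite A" "A \<noteq> {}" "i \<notin> A"
  shows "rot i w A i = w (Min A)"
  using assms
proof (induction A rule: finite_linorder_min_induct)
  case (insert b A)
  then have "Min (insert b A) = b" by (intro Min_eqI) auto
  then show ?case using insert by (auto simp: rot_insert_min rot_outside)
qed simp

lemma rot_moved:
  assumes "inj w" "finite A" "i \<notin> A" "a \<in> A"
  shows "rot i w A a \<noteq> w a"
  using assms(2-4)
proof (induction A arbitrary: a rule: finite_linorder_min_induct)
  case (insert b A)
  show ?case
  proof (cases "a = b")
    case True
    have "rot i w A i \<noteq> w b"
    proof (cases "A = {}")
      case False
      then have "Min A \<in> A" using insert by simp
      then have "Min A \<noteq> b" using insert by auto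
      then show ?thesis using False insert rot_at[of A i w] assms(1) by (auto dest: injD)
    qed (use insert assms(1) in \<open>auto dest: injD\<close>)
    then show ?thesis using True insert by (simp add: rot_insert_min)
  next
    case False
    moreover have "a \<noteq> i" using insert.prems False by auto
    ultimately have "rot i w (insert b A) a = rot i w A a" using insert by (simp add: rot_insert_min)
    then show ?thesis using False insert by auto
  qed
qed simp

text \<open>A is recovered as the set of positions other than i whose value has changed. Sums over
  subsets can therefore be rewritten as sums over the permutations they yield.\<close>

lemma inj_on_rot:
  assumes "inj w"
  shows "inj_on (rot i w) {A. finite A \<and> i \<notin> A}"
proof (rule inj_onI)
  fix A B assume *: "A \<in> {A. finite A \<and> i \<notin> A}" "B \<in> {A. finite A \<and> i \<notin> A}" "rot i w A = rot i w B"
  have moved: "A = {a. a \<noteq> i \<and> rot i w A a \<noteq> w a}" if "finite A" "i \<notin> A" for A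
    using rot_moved[OF assms that] rot_outside[OF that(1)] that by auto
  show "A = B" using moved[of A] moved[of B] * by simp
qed

text \<open>Moving \<open>simple i\<close> past (i + 1, b) turns it into (i, b). This relates the
  permutations reached from w s_i at i + 1 to those reached from w at i.\<close>

lemma rot_simple:
  "finite B \<Longrightarrow> \<forall>b\<in>B. Suc i < b \<Longrightarrow> rot (Suc i) (w \<circ> simple i) B \<circ> simple i = rot i w B"
proof (induction B rule: finite_linorder_min_induct)
  case (insert b B)
  have "transp (Suc i) b \<circ> simple i = simple i \<circ> transp i b"
    using insert.prems by (auto simp: fun_eq_iff simple_def Transposition.transpose_def)
  then have "rot (Suc i) (w \<circ> simple i) (insert b B) \<circ> simple i =
    rot (Suc i) (w \<circ> simple i) B \<circ> simple i \<circ> transp i b"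
    using insert by (simp add: rot_insert_min comp_assoc)
  also have "rot (Suc i) (w \<circ> simple i) B \<circ> simple i = rot i w B"
    using insert by blast
  also have "rot i w B \<circ> transp i b = rot i w (insert b B)"
    using insert by (simp add: rot_insert_min)
  finally show ?case .
qed (simp add: comp_simple_simple)

lemma rot_insert_Suc:
  assumes "finite B" "\<forall>b\<in>B. Suc i < b"
  shows "rot i w (insert (Suc i) B) = rot (Suc i) (w \<circ> simple i) B"
proof -
  have "rot i w (insert (Suc i) B) = rot i w B \<circ> simple i"
    using assms by (simp add: rot_insert_min simple_def)
  also have "\<dots> = rot (Suc i) (w \<circ> simple i) B"
    unfolding rot_simple[OF assms, symmetric] by (rule comp_simple_simple)
  finally show ?thesis .
qed

section \<open>Subsets of \<open>phi\<close> and the steps they induce\<close>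

lemma phi_greater: "a \<in> phi i w \<Longrightarrow> i < a \<and> w i < w a"
  by (simp add: phi_def)

lemma phi_decreasing:
  assumes "inj w" "a \<in> phi i w" "b \<in> phi i w" "a < b"
  shows "w b < w a"
proof -
  have "\<not> w a < w b" using assms(2-4) by (auto simp: phi_def)
  moreover have "w a \<noteq> w b" using assms(1,4) by (auto dest: injD)
  ultimately show ?thesis by simp
qed

text \<open>At an ascent i + 1 is a member, and it blocks all later positions with values above w (i
  + 1). For the other later positions the conditions at i in w and at i + 1 in w s_i agree, as both
  compare with the value w i.\<close>

lemma phi_insert:
  assumes "w i < w (Suc i)" "inj w"
  shows "phi i w = insert (Suc i) {a \<in> phi (Suc i) (w \<circ> simple i). w a < w (Suc i)}"
proof (intro equalityI subsetI)
  fix a assume a: "a \<in> phi i w"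
  show "a \<in> insert (Suc i) {a \<in> phi (Suc i) (w \<circ> simple i). w a < w (Suc i)}"
  proof (cases "a = Suc i")
    case False
    with a have "Suc i < a" by (simp add: phi_def)
    moreover have "\<not> w (Suc i) < w a" using a assms(1) \<open>Suc i < a\<close> by (auto simp: phi_def)
    moreover have "w a \<noteq> w (Suc i)" using assms(2) False by (auto dest: injD)
    ultimately show ?thesis using a by (auto simp: phi_def)
  qed simp
next
  fix a assume a: "a \<in> insert (Suc i) {a \<in> phi (Suc i) (w \<circ> simple i). w a < w (Suc i)}"
  show "a \<in> phi i w"
  proof (cases "a = Suc i")
    case False
    with a have *: "a \<in> phi (Suc i) (w \<circ> simple i)" "w a < w (Suc i)" by auto
    have "\<not> (w i < w a' \<and> w a' < w a)" if "i < a'" "a' < a" for a'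
    proof (cases "a' = Suc i")
      case False
      then show ?thesis using * that by (auto simp: phi_def)
    qed (use * in auto)
    then show ?thesis using * by (auto simp: phi_def)
  qed (use assms in \<open>auto simp: phi_def\<close>)
qed

text \<open>Values decrease along \<open>phi i w\<close>, so with indices processed downwards each
  transposition exchanges the value at i with a larger one further right. Every step goes up in
  Bruhat order and lowers the weight.\<close>

lemma rot_phi:
  assumes w: "w \<in> Sym n" and i: "1 \<le> i" "i \<le> n" and A: "A \<subseteq> phi i w" "A \<subseteq> {..n}"
  shows "rot i w A \<in> Sym n" "bruhat_le w (rot i w A)" "A \<noteq> {} \<Longrightarrow> weight n (rot i w A) < weight n w"
proof -
  note inj = Sym_imp_inj[OF w]
  have "finite A" using A finite_subset by blast
  then have "rot i w A \<in> Sym n \<and> bruhat_le w (rot i w A) \<and>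
    weight n (rot i w A) \<le> weight n w \<and> (A \<noteq> {} \<longrightarrow> weight n (rot i w A) < weight n w)"
    using A
  proof (induction A rule: finite_linorder_min_induct)
    case (insert b A)
    then have IH: "rot i w A \<in> Sym n" "bruhat_le w (rot i w A)" "weight n (rot i w A) \<le> weight n w"
      by auto
    have b: "i < b" "w i < w b" "b \<le> n" "b \<notin> A"
      using insert.hyps insert.prems phi_greater[of b i w] by auto
    have "i \<notin> A" using insert.prems phi_greater by blast
    have "rot i w A i < w b"
    proof (cases "A = {}")
      case True
      show ?thesis unfolding True rot_empty by (rule b(2))
    next
      case False
      then have "Min A \<in> A" using insert by simp
      then have "w (Min A) < w b"
        using insert.prems insert.hyps(2) by (intro phi_decreasing[OF inj, of b i "Min A"]) auto
      then show ?thesis using rot_at[OF insert.hyps(1) False \<open>i \<notin> A\<close>] by simp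
    qed
    then have lt: "rot i w A i < rot i w A b"
      using b rot_outside[OF insert.hyps(1), of b i w] by simp
    have eq: "rot i w (insert b A) = rot i w A \<circ> transp i b"
      using insert.hyps by (intro rot_insert_min)
    have "len (rot i w A) < len (rot i w A \<circ> transp i b)"
      using IH(1) i b lt by (intro len_transp_less)
    then have "bruhat_le w (rot i w A \<circ> transp i b)"
      using IH(2) i b by (intro bruhat_le.step)
    moreover have "weight n (rot i w A \<circ> transp i b) < weight n (rot i w A)"
      using i b lt by (intro weight_transp_less)
    moreover have "rot i w A \<circ> transp i b \<in> Sym n"
      using IH(1) i b by (intro Sym_comp transp_in_Sym) auto
    ultimately have "rot i w (insert b A) \<in> Sym n" "bruhat_le w (rot i w (insert b A))"
      "weight n (rot i w (insert b A)) < weight n (rot i w A)"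
      unfolding eq by blast+
    then show ?case using IH(3) by linarith
  next
    case empty
    show ?case unfolding rot_empty using w bruhat_le.refl by blast
  qed
  then show "rot i w A \<in> Sym n" "bruhat_le w (rot i w A)"
    "A \<noteq> {} \<Longrightarrow> weight n (rot i w A) < weight n w" by auto
qed

section \<open>The co-transition formula\<close>

text \<open>The values below j already sit where \<open>w0 n\<close> puts them, while j sits at i,
  left of its final position n + 1 - j. Stated without diagrams, the condition visibly survives
  passing to w s_i and i + 1 as long as i + 1 + j <= n.\<close>

definition corner :: "nat \<Rightarrow> perm \<Rightarrow> nat \<Rightarrow> nat \<Rightarrow> bool" where
  "corner n w i j \<longleftrightarrow> w \<in> Sym n \<and> 1 \<le> i \<and> 1 \<le> j \<and> i + j \<le> n \<and> w i = j \<and>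
     (\<forall>k. 1 \<le> k \<and> k < j \<longrightarrow> w (n + 1 - k) = k)"

lemma corner_Sym: "corner n w i j \<Longrightarrow> w \<in> Sym n"
  by (simp add: corner_def)

text \<open>All positive values smaller than j lie to the right of position n + 1 - j.\<close>

lemma corner_less:
  assumes c: "corner n w i j" and p: "1 \<le> p" "p + j \<le> n + 1" "p \<noteq> i"
  shows "w i < w p"
proof (rule ccontr)
  assume neg: "\<not> w i < w p"
  have w: "w \<in> Sym n" and ij: "w i = j" "i + j \<le> n" "1 \<le> i" "1 \<le> j"
    using c by (auto simp: corner_def)
  have "w p \<noteq> w i" using Sym_inj[OF w] p by blast
  then have "w p < j" using neg ij by simp
  moreover have "1 \<le> w p" using Sym_range[OF w, of p] p ij by simp
  ultimately have "w (n + 1 - w p) = w p" using c by (simp add: corner_def)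
  then have "n + 1 - w p = p" using Sym_inj[OF w] by blast
  then show False using \<open>w p < j\<close> p by simp
qed

lemma corner_ascent: "corner n w i j \<Longrightarrow> w i < w (Suc i)"
  using corner_less[of n w i j "Suc i"] by (auto simp: corner_def)

lemma corner_shift:
  assumes "corner n w i j" "Suc i + j \<le> n"
  shows "corner n (w \<circ> simple i) (Suc i) j"
proof -
  have "(w \<circ> simple i) (n + 1 - k) = k" if "1 \<le> k" "k < j" for k
  proof -
    have "simple i (n + 1 - k) = n + 1 - k" using that assms(2) by (intro simple_simps) auto
    then show ?thesis using assms(1) that by (simp add: corner_def)
  qed
  moreover have "w \<circ> simple i \<in> Sym n"
    using assms unfolding corner_def by (intro Sym_comp simple_in_Sym) auto
  ultimately show ?thesis
    unfolding corner_def using assms(2) assms(1)[unfolded corner_def] by (intro conjI allI impI) auto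
qed

lemma corner_phi:
  assumes "corner n w i j"
  shows "phi i w \<subseteq> {Suc i..n}"
proof
  fix a assume a: "a \<in> phi i w"
  have w: "w \<in> Sym n" and i: "1 \<le> i" "Suc i \<le> n" using assms by (auto simp: corner_def)
  have "a \<le> n"
  proof (rule ccontr)
    assume "\<not> a \<le> n"
    then have "w a = a" "w (Suc i) < a" "Suc i < a"
      using Sym_outside[OF w, of a] Sym_range[OF w, of "Suc i"] i by auto
    then show False using a corner_ascent[OF assms] unfolding phi_def by auto
  qed
  then show "a \<in> {Suc i..n}" using phi_greater[OF a] by auto
qed

section \<open>The extreme case of the co-transition formula\<close>

lemma staircase_factor:
  assumes "1 \<le> k" "k < n"
  obtains T where "staircase n = X k * T" "swap_vars k T = T"
proof -
  \<comment> \<open>The exponents of x_k and x_(k+1) in the staircase differ by one, so a single x_k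
    is left over beside a power of x_k x_(k+1).\<close>
  define R where "R = (\<Prod>a\<in>{1..n} - {k} - {Suc k}. X a ^ (n - a))"
  define T where "T = (X k * X (Suc k)) ^ (n - Suc k) * R"
  have "staircase n = (\<Prod>a\<in>{1..n}. X a ^ (n - a))"
    unfolding staircase_def by (rule prod.mono_neutral_left) auto
  also have "\<dots> = X k ^ (n - k) * (X (Suc k) ^ (n - Suc k) * R)"
    unfolding R_def using assms
    by (subst prod.remove[of _ k], simp, simp, subst prod.remove[of _ "Suc k"]) auto
  also have "n - k = Suc (n - Suc k)" using assms by simp
  finally have "staircase n = X k * T" unfolding T_def by (simp add: power_mult_distrib mult_ac)
  moreover have "swap_vars k R = R"
    unfolding R_def swap_vars_prod by (rule prod.cong) auto
  then have "swap_vars k T = T" unfolding T_def by (simp add: mult.commute)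
  ultimately show thesis by (rule that)
qed

text \<open>Here v decreases before position l, is free at l and agrees with \<open>w0 n\<close>
  beyond. The free entry is either the smallest so far and joins the final part, or it moves one
  step to the left, which costs one variable of the staircase. The quotient is stated as a product
  to stay among polynomials.\<close>

lemma grothendieck_beta_decreasing_prefix:
  assumes "v \<in> Sym n" "1 \<le> l" "l \<le> n"
    and "\<And>p. l < p \<Longrightarrow> p \<le> n \<Longrightarrow> v p = n + 1 - p"
    and "\<And>k. 1 \<le> k \<Longrightarrow> Suc k < l \<Longrightarrow> v (Suc k) < v k"
  shows "\<exists>K. K \<subseteq> {1..<l} \<and> grothendieck_beta n \<beta> v * (\<Prod>r\<in>K. X r) = staircase n"
  using assms(2,1,3-)
proof (induction l arbitrary: v rule: dec_induct)
  case base
  have one: "v 1 = n"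
    using minimal_prefix_value[OF base(1) _ base(2)] base(3) by simp
  have "v = w0 n"
  proof (rule decreasing_imp_w0[OF base(1)])
    fix k assume k: "1 \<le> k" "k < n"
    show "v (Suc k) < v k"
    proof (cases "k = 1")
      case True
      then show ?thesis using one k base(3)[of 2] by (simp add: numeral_2_eq_2)
    next
      case False
      then show ?thesis using k base(3)[of k] base(3)[of "Suc k"] by simp
    qed
  qed
  then show ?case by (intro exI[of _ "{}"]) (simp add: grothendieck_beta_w0)
next
  case (step l)
  note v = step.prems(1)
  have dec: "v q < v p" if "1 \<le> p" "p < q" "q \<le> l" for p q
    using decreasing_on[of l v p q] step.prems(4) that by simp
  show ?case
  proof (cases "v l < v (Suc l)")
    case False
    then have last: "v (Suc l) < v l" using not_ascent[OF v] by blast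
    have "v (Suc l) = n + 1 - Suc l"
    proof (rule minimal_prefix_value[OF v])
      fix p assume p: "1 \<le> p" "p < Suc l"
      show "v (Suc l) < v p"
        using last dec[of p l] p by (cases "p = l") auto
    qed (use step.prems in auto)
    then have "v p = n + 1 - p" if "l < p" "p \<le> n" for p
      using step.prems(3) that by (cases "p = Suc l") auto
    then have "\<exists>K. K \<subseteq> {1..<l} \<and> grothendieck_beta n \<beta> v * (\<Prod>r\<in>K. X r) = staircase n"
      using step.prems by (intro step.IH) auto
    moreover have "{1..<l} \<subseteq> {1..<Suc l}" by auto
    ultimately show ?thesis by (meson subset_trans)
  next
    case True
    let ?v = "v \<circ> simple l"
    have l: "1 \<le> l" "l < n" using step by auto
    have v': "?v \<in> Sym n" using v l by (intro Sym_comp simple_in_Sym)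
    have above: "?v p = n + 1 - p" if "Suc l < p" "p \<le> n" for p
      using step.prems(3) that by simp
    have "?v (Suc l) = n + 1 - Suc l"
    proof (rule minimal_prefix_value[OF v'])
      fix p assume p: "1 \<le> p" "p < Suc l"
      show "?v (Suc l) < ?v p"
        using True dec[of p l] p by (cases "p = l") auto
    qed (use above l in auto)
    then have "?v p = n + 1 - p" if "l < p" "p \<le> n" for p
      using above that by (cases "p = Suc l") auto
    then have "\<exists>K. K \<subseteq> {1..<l} \<and> grothendieck_beta n \<beta> ?v * (\<Prod>r\<in>K. X r) = staircase n"
      using step.prems v' l by (intro step.IH[OF v']) auto
    then obtain K where K: "K \<subseteq> {1..<l}" "grothendieck_beta n \<beta> ?v * (\<Prod>r\<in>K. X r) = staircase n"
      by blast
    obtain T where T: "staircase n = X l * T" "swap_vars l T = T"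
      using staircase_factor l by blast
    have "swap_vars l (\<Prod>r\<in>K. X r) = (\<Prod>r\<in>K. X r)"
      unfolding swap_vars_prod using K(1) by (intro prod.cong) auto
    \<comment> \<open>The monomial of K avoids x_l and x_(l+1), so it passes through the operator.
      What remains inside is the staircase x_l T, from which the operator strips x_l.\<close>
    then have "(\<Prod>r\<in>K. X r) * grothendieck_beta n \<beta> v =
      demazure_op \<beta> l ((\<Prod>r\<in>K. X r) * grothendieck_beta n \<beta> ?v)"
      by (simp add: demazure_op_mult_symmetric grothendieck_beta_ascent[OF v l True])
    also have "\<dots> = T"
      using K(2) T by (simp add: mult.commute[of "prod X K"] demazure_op_X_mult_symmetric)
    finally have "grothendieck_beta n \<beta> v * (\<Prod>r\<in>insert l K. X r) = staircase n"
      using K(1) finite_subset[OF K(1)] T(1) by (subst prod.insert) (auto simp: mult_ac)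
    moreover have "insert l K \<subseteq> {1..<Suc l}" using K(1) l by auto
    ultimately show ?thesis by blast
  qed
qed

text \<open>
  With \<open>v = w s\<^sub>i\<close> this amounts to the co-transition formula \<open>x\<^sub>i G\<^sub>w = G\<^sub>v\<close> in the extreme case \<open>i + j = n\<close>.
  Ascents of \<open>v\<close> below \<open>i - 1\<close> commute with everything in sight, and without them \<open>v\<close> has
  a monomial as its polynomial.
\<close>

lemma swap_vars_X_mult_grothendieck_beta:
  assumes "v \<in> Sym n" "1 \<le> i" "i < n" "\<And>p. i < p \<Longrightarrow> p \<le> n \<Longrightarrow> v p = n + 1 - p"
  shows "swap_vars i (X (Suc i) * grothendieck_beta n \<beta> v) = X (Suc i) * grothendieck_beta n \<beta> v"
  using assms(1,4)
proof (induction "weight n v" arbitrary: v rule: less_induct)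
  case less
  show ?case
  proof (cases "\<exists>k. 1 \<le> k \<and> Suc k < i \<and> v k < v (Suc k)")
    case True
    then obtain k where k: "1 \<le> k" "Suc k < i" "v k < v (Suc k)" by blast
    let ?v = "v \<circ> simple k"
    have "X (Suc i) * grothendieck_beta n \<beta> v = demazure_op \<beta> k (X (Suc i) * grothendieck_beta n \<beta> ?v)"
      using k assms(3) less.prems(1)
      by (simp add: demazure_op_mult_symmetric grothendieck_beta_ascent[of v n k])
    moreover have "swap_vars i (X (Suc i) * grothendieck_beta n \<beta> ?v) = X (Suc i) * grothendieck_beta n \<beta> ?v"
    proof (rule less.hyps)
      show "weight n ?v < weight n v" using k assms(3) by (intro weight_simple_less) auto
      show "?v \<in> Sym n" using less.prems(1) k assms(3) by (intro Sym_comp simple_in_Sym) auto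
      show "?v p = n + 1 - p" if "i < p" "p \<le> n" for p
        using less.prems(2) that k by simp
    qed
    ultimately show ?thesis
      using k(2) by (metis Suc_eq_plus1 swap_vars_demazure_op_commute)
  next
    case False
    then have "v (Suc k) < v k" if "1 \<le> k" "Suc k < i" for k
      using not_ascent[OF less.prems(1)] that by blast
    then obtain K where K: "K \<subseteq> {1..<i}" "grothendieck_beta n \<beta> v * (\<Prod>r\<in>K. X r) = staircase n"
      using grothendieck_beta_decreasing_prefix[of v n i \<beta>] less.prems assms by auto
    obtain T where T: "staircase n = X i * T" "swap_vars i T = T"
      using staircase_factor assms by blast
    have fin: "finite K" using K(1) finite_subset by blast
    \<comment> \<open>Up to a monomial symmetric in x_i and x_(i+1), the polynomial is x_i T with T
      symmetric, so the factor x_(i+1) completes it to a symmetric one.\<close>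
    have "swap_vars i (\<Prod>r\<in>K. X r) = (\<Prod>r\<in>K. X r)"
      unfolding swap_vars_prod using K(1) by (intro prod.cong) auto
    then have "swap_vars i (X (Suc i) * grothendieck_beta n \<beta> v) * (\<Prod>r\<in>K. X r) =
      swap_vars i (X (Suc i) * (grothendieck_beta n \<beta> v * (\<Prod>r\<in>K. X r)))"
      by simp
    also have "\<dots> = X (Suc i) * (grothendieck_beta n \<beta> v * (\<Prod>r\<in>K. X r))"
      unfolding K(2) T(1) using T(2) by (simp add: mult_ac)
    finally have "swap_vars i (X (Suc i) * grothendieck_beta n \<beta> v) * (\<Prod>r\<in>K. X r) =
      X (Suc i) * grothendieck_beta n \<beta> v * (\<Prod>r\<in>K. X r)"
      by (simp add: mult_ac)
    moreover have "(\<Prod>r\<in>K. X r) \<noteq> 0" using fin by simp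
    ultimately show ?thesis by simp
  qed
qed

text \<open>Induction on n - i, passing to v = w s_i at i + 1. On the term of a subset B of
  \<open>phi (Suc i) v\<close> the operator either produces the permutation of B at (w, i) or acts
  as the scalar -\<beta>. The surviving terms are indexed by the subsets of \<open>phi i w\<close>
  without i + 1, those with i + 1 and further elements, and the singleton of i + 1.\<close>

theorem cotransition:
  assumes "corner n w i j"
  shows "X i * grothendieck_beta n \<beta> w =
    (\<Sum>A | A \<noteq> {} \<and> A \<subseteq> phi i w. of_int \<beta> ^ (card A - 1) * grothendieck_beta n \<beta> (rot i w A))"
  using assms
proof (induction "n - i" arbitrary: w i rule: less_induct)
  case less
  let ?g = "grothendieck_beta n \<beta>"
  let ?w = "w \<circ> simple i"
  let ?\<beta> = "of_int \<beta> :: mpol"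
  note c = less.prems
  note w = corner_Sym[OF c]
  note asc = corner_ascent[OF c]
  have i: "1 \<le> i" "i < n" "i + j \<le> n" using c by (auto simp: corner_def)
  have w': "?w \<in> Sym n" using w i by (intro Sym_comp simple_in_Sym)
  have main: "X i * ?g w = demazure_op \<beta> i (X (Suc i) * ?g ?w) + ?\<beta> * (X (Suc i) * ?g ?w) + ?g ?w"
    unfolding grothendieck_beta_ascent[OF w i(1,2) asc] demazure_op_X_Suc_mult
    by (simp add: algebra_simps)
  note phi = phi_insert[OF asc Sym_imp_inj[OF w]]
  show ?case
  proof (cases "i + j = n")
    case True
    have last: "?w p = n + 1 - p" if "i < p" "p \<le> n" for p
    proof (cases "p = Suc i")
      case False
      then have "1 \<le> n + 1 - p" "n + 1 - p < j" using True that by auto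
      then have "w (n + 1 - (n + 1 - p)) = n + 1 - p"
        using c unfolding corner_def by blast
      then show ?thesis using that False by simp
    qed (use c True in \<open>auto simp: corner_def\<close>)
    \<comment> \<open>By this symmetry the operator acts as the scalar -\<beta>, so the first two
      summands of \<open>main\<close> cancel.\<close>
    have "swap_vars i (X (Suc i) * ?g ?w) = X (Suc i) * ?g ?w"
      using w' i last by (intro swap_vars_X_mult_grothendieck_beta)
    then have "X i * ?g w = ?g ?w"
      unfolding main by (subst demazure_op_symmetric) simp_all
    moreover have "phi i w = {Suc i}"
    proof -
      have "w (Suc i) \<le> w a" if "Suc i < a" "a \<in> phi i w" for a
      proof -
        have "a \<le> n" using corner_phi[OF c] that by auto
        then have "?w a \<le> j" using last[of a] that True by simp
        then have "w a \<le> w i" using that c by (simp add: corner_def)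
        then show ?thesis using phi_greater[OF that(2)] by simp
      qed
      moreover have "a = Suc i \<or> Suc i < a \<and> w a < w (Suc i)" if "a \<in> phi i w" for a
        using that phi corner_phi[OF c] by (cases "a = Suc i") auto
      moreover have "Suc i \<in> phi i w" using phi by blast
      ultimately show ?thesis using not_less by blast
    qed
    moreover have "{A. A \<noteq> {} \<and> A \<subseteq> {Suc i}} = {{Suc i}}" by auto
    ultimately show ?thesis by (simp add: simple_def)
  next
    case False
    let ?phi = "phi (Suc i) ?w"
    \<comment> \<open>By \<open>phi_insert\<close> this is \<open>phi i w\<close> without i +
      1.\<close>
    define R where "R = {a \<in> ?phi. w a < w (Suc i)}"
    define coef where "coef = (\<lambda>A :: nat set. ?\<beta> ^ (card A - 1))"
    define u where "u = rot (Suc i) ?w"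
    define P where "P = {B. B \<noteq> {} \<and> B \<subseteq> ?phi}"
    define Q where "Q = {B. B \<noteq> {} \<and> B \<subseteq> R}"
    have c': "corner n ?w (Suc i) j" using c False i by (intro corner_shift) auto
    have IH: "X (Suc i) * ?g ?w = (\<Sum>B\<in>P. coef B * ?g (u B))"
      using less.hyps[OF _ c'] i unfolding P_def coef_def u_def by simp
    have fin: "finite ?phi" using corner_phi[OF c'] finite_subset by blast
    then have "finite R" and finP: "finite P" unfolding R_def P_def by auto
    have "Q \<subseteq> P" unfolding Q_def P_def R_def by auto
    have finQ: "finite Q" using \<open>Q \<subseteq> P\<close> finP finite_subset by blast
    have inj': "inj ?w" using Sym_imp_inj[OF w'] .
    have fB: "finite B" "\<forall>b\<in>B. Suc i < b" "B \<noteq> {}" "Min B \<in> B" "B \<subseteq> ?phi" if "B \<in> P" for B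
    proof -
      show B: "B \<noteq> {}" "B \<subseteq> ?phi" using that unfolding P_def by auto
      then show fB: "finite B" using fin finite_subset by blast
      show "Min B \<in> B" using fB B(1) by simp
      show "\<forall>b\<in>B. Suc i < b" using B(2) phi_greater by blast
    qed
    have u_i: "u B i = w (Suc i)" "u B (Suc i) = w (Min B)" "u B \<in> Sym n" if "B \<in> P" for B
    proof -
      note B = fB[OF that]
      have "i \<notin> B" using B(2) by auto
      show "u B i = w (Suc i)" unfolding u_def using rot_outside[OF B(1) \<open>i \<notin> B\<close>, of "Suc i"] by simp
      have "Suc i \<notin> B" "Min B \<noteq> i" "Min B \<noteq> Suc i" using B(2,4) by auto
      then show "u B (Suc i) = w (Min B)" unfolding u_def using rot_at[OF B(1,3)] by simp
      show "u B \<in> Sym n" unfolding u_def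
        using B(5) corner_phi[OF c'] i by (intro rot_phi[OF w']) auto
    qed
    have term_Q: "demazure_op \<beta> i (?g (u B)) = ?g (rot i w B)" if "B \<in> Q" for B
    proof -
      have "B \<in> P" using that \<open>Q \<subseteq> P\<close> by blast
      note B = fB[OF this] and u = u_i[OF this]
      have "w (Min B) < w (Suc i)" using that B(4) unfolding Q_def R_def by blast
      then have "demazure_op \<beta> i (?g (u B)) = ?g (u B \<circ> simple i)"
        using u i by (simp add: demazure_op_grothendieck_beta)
      then show ?thesis unfolding u_def rot_simple[OF B(1,2)] .
    qed
    \<comment> \<open>The sets \<open>B\<close> outside \<open>Q\<close> are no subsets of \<open>\<phi>\<^sub>i(w)\<close>, but their two contributions cancel.\<close>
    have term_P: "demazure_op \<beta> i (?g (u B)) = - ?\<beta> * ?g (u B)" if PQ: "B \<in> P - Q" for B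
    proof -
      have "B \<in> P" using PQ by blast
      note B = fB[OF this] and u = u_i[OF this]
      obtain b where b: "b \<in> B" "\<not> w b < w (Suc i)"
        using PQ unfolding P_def Q_def R_def by blast
      \<comment> \<open>Values decrease along \<open>phi\<close>, so the value at
        \<open>Min B\<close> is the largest on B and inherits the bound from b.\<close>
      have "\<not> w (Min B) < w (Suc i)"
      proof (cases "b = Min B")
        case False
        then have "Min B < b" using b(1) B(1) by (simp add: le_neq_trans)
        then have "?w b < ?w (Min B)"
          using b(1) B(4,5) by (intro phi_decreasing[OF inj', of _ "Suc i"]) auto
        moreover have "Suc i < b" "Suc i < Min B" using B(2,4) b(1) by auto
        ultimately show ?thesis using b(2) by simp
      qed (use b in simp)
      then show ?thesis using u i by (simp add: demazure_op_grothendieck_beta)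
    qed
    have op_coef: "demazure_op \<beta> i (coef B * f) = coef B * demazure_op \<beta> i f" for B f
      by (rule demazure_op_mult_symmetric) (simp add: coef_def)
    have "X i * ?g w = (\<Sum>B\<in>P. coef B * (demazure_op \<beta> i (?g (u B)) + ?\<beta> * ?g (u B))) + ?g ?w"
      unfolding main IH
      by (simp add: demazure_op_sum op_coef sum_distrib_left sum.distrib distrib_left mult_ac)
    also have "(\<Sum>B\<in>P. coef B * (demazure_op \<beta> i (?g (u B)) + ?\<beta> * ?g (u B))) =
      (\<Sum>B\<in>Q. coef B * (?g (rot i w B) + ?\<beta> * ?g (u B)))"
      by (rule sum.mono_neutral_cong_right) (use finP \<open>Q \<subseteq> P\<close> term_P term_Q in auto)
    also have "\<dots> = (\<Sum>B\<in>Q. coef B * ?g (rot i w B)) + (\<Sum>B\<in>Q. ?\<beta> * coef B * ?g (u B))"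
      by (simp add: sum.distrib distrib_left mult_ac)
    \<comment> \<open>Adding i + 1 to a nonempty B raises the exponent of \<beta> by one, which
      absorbs the extra factor.\<close>
    also have "(\<Sum>B\<in>Q. ?\<beta> * coef B * ?g (u B)) =
      (\<Sum>A\<in>insert (Suc i) ` Q. coef A * ?g (rot i w A))"
    proof -
      have Suc_notin: "Suc i \<notin> B" if "B \<in> Q" for B
        using fB(2)[of B] that \<open>Q \<subseteq> P\<close> by auto
      have "inj_on (insert (Suc i)) Q"
        using Suc_notin by (intro inj_onI) (metis insert_ident)
      moreover have "coef (insert (Suc i) B) = ?\<beta> * coef B" if "B \<in> Q" for B
      proof -
        have "B \<in> P" using that \<open>Q \<subseteq> P\<close> by blast
        then have "card B > 0" using fB(1,3) by (simp add: card_gt_0_iff)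
        then obtain m where "card B = Suc m" using gr0_implies_Suc by blast
        then show ?thesis
          unfolding coef_def using Suc_notin[OF that] fB(1)[OF \<open>B \<in> P\<close>] by simp
      qed
      moreover have "rot i w (insert (Suc i) B) = u B" if "B \<in> Q" for B
        unfolding u_def using fB(1,2)[of B] that \<open>Q \<subseteq> P\<close> by (intro rot_insert_Suc) auto
      ultimately show ?thesis by (simp add: sum.reindex)
    qed
    also have "?g ?w = (\<Sum>A\<in>{{Suc i}}. coef A * ?g (rot i w A))"
      by (simp add: coef_def simple_def)
    also have "(\<Sum>B\<in>Q. coef B * ?g (rot i w B)) + (\<Sum>A\<in>insert (Suc i) ` Q. coef A * ?g (rot i w A))
        + (\<Sum>A\<in>{{Suc i}}. coef A * ?g (rot i w A)) =
      (\<Sum>A\<in>Q \<union> insert (Suc i) ` Q \<union> {{Suc i}}. coef A * ?g (rot i w A))"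
    proof -
      have notin: "Suc i \<notin> B" "B \<noteq> {}" if "B \<in> Q" for B
        using fB(2,3)[of B] that \<open>Q \<subseteq> P\<close> by auto
      then have "Q \<inter> insert (Suc i) ` Q = {}" "(Q \<union> insert (Suc i) ` Q) \<inter> {{Suc i}} = {}"
        by auto
      then show ?thesis using finQ by (simp only: sum.union_disjoint finite_UnI finite_imageI finite.intros)
    qed
    also have "Q \<union> insert (Suc i) ` Q \<union> {{Suc i}} = {A. A \<noteq> {} \<and> A \<subseteq> phi i w}"
    proof (intro equalityI subsetI)
      fix A assume "A \<in> Q \<union> insert (Suc i) ` Q \<union> {{Suc i}}"
      then show "A \<in> {A. A \<noteq> {} \<and> A \<subseteq> phi i w}"
        unfolding Q_def phi R_def by auto
    next
      fix A assume "A \<in> {A. A \<noteq> {} \<and> A \<subseteq> phi i w}"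
      then have A: "A \<noteq> {}" "A \<subseteq> insert (Suc i) R" unfolding phi R_def by auto
      show "A \<in> Q \<union> insert (Suc i) ` Q \<union> {{Suc i}}"
      proof (cases "Suc i \<in> A")
        case True
        then have "A = insert (Suc i) (A - {Suc i})" by auto
        moreover have "A - {Suc i} \<in> Q \<or> A - {Suc i} = {}" using A unfolding Q_def by auto
        ultimately show ?thesis by (metis UnI1 UnI2 image_eqI insertI1)
      qed (use A in \<open>auto simp: Q_def\<close>)
    qed
    finally show ?thesis unfolding coef_def .
  qed
qed

section \<open>The co-transition formula along the edges of the graphs\<close>

lemma Phi_bar_eq:
  assumes "corner n w i j"
  shows "Phi_bar i w = rot i w ` {A. A \<noteq> {} \<and> A \<subseteq> phi i w}"
proof -
  have "finite (phi i w)" using corner_phi[OF assms] finite_subset by blast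
  then have "{A. finite A \<and> A \<noteq> {} \<and> A \<subseteq> phi i w} = {A. A \<noteq> {} \<and> A \<subseteq> phi i w}"
    using finite_subset by blast
  then show ?thesis unfolding Phi_bar_def rot_def setcompr_eq_image by (rule arg_cong)
qed

lemma inj_on_rot_phi:
  assumes "corner n w i j"
  shows "inj_on (rot i w) {A. A \<noteq> {} \<and> A \<subseteq> phi i w}"
proof (rule inj_on_subset[OF inj_on_rot])
  show "inj w" using Sym_imp_inj[OF corner_Sym[OF assms]] .
  show "{A. A \<noteq> {} \<and> A \<subseteq> phi i w} \<subseteq> {A. finite A \<and> i \<notin> A}"
    using corner_phi[OF assms] by (auto intro: finite_subset)
qed

lemma X_mult_grothendieck_beta_1:
  assumes "corner n w i j"
  shows "X i * grothendieck_beta n 1 w = (\<Sum>u\<in>Phi_bar i w. grothendieck_beta n 1 u)"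
  unfolding cotransition[OF assms] Phi_bar_eq[OF assms] sum.reindex[OF inj_on_rot_phi[OF assms]]
  by simp

text \<open>With parameter 0 only the singletons survive in the co-transition formula, by 0 ^ 0 = 1,
  and they give the single transpositions in \<open>Phi\<close>.\<close>

lemma X_mult_grothendieck_beta_0:
  assumes "corner n w i j"
  shows "X i * grothendieck_beta n 0 w = (\<Sum>u\<in>Phi i w. grothendieck_beta n 0 u)"
proof -
  let ?S = "{A. A \<noteq> {} \<and> A \<subseteq> phi i w}"
  have fin: "finite (phi i w)" using corner_phi[OF assms] finite_subset by blast
  have sub: "(\<lambda>a. {a}) ` phi i w \<subseteq> ?S" by auto
  have Phi: "Phi i w = rot i w ` (\<lambda>a. {a}) ` phi i w"
    unfolding Phi_def by (auto simp: image_iff)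
  have "inj_on (rot i w) ((\<lambda>a. {a}) ` phi i w)"
    using inj_on_rot_phi[OF assms] sub inj_on_subset by blast
  then have "(\<Sum>u\<in>Phi i w. grothendieck_beta n 0 u) =
    (\<Sum>A\<in>(\<lambda>a. {a}) ` phi i w. grothendieck_beta n 0 (rot i w A))"
    unfolding Phi by (simp only: sum.reindex o_def)
  also have "\<dots> = (\<Sum>A\<in>?S. of_int 0 ^ (card A - 1) * grothendieck_beta n 0 (rot i w A))"
  proof (rule sum.mono_neutral_cong_left[OF _ sub])
    show "finite ?S" using fin by simp
    show "\<forall>A\<in>?S - (\<lambda>a. {a}) ` phi i w. of_int 0 ^ (card A - 1) * grothendieck_beta n 0 (rot i w A) = 0"
    proof
      fix A assume A: "A \<in> ?S - (\<lambda>a. {a}) ` phi i w"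
      then have "finite A" using fin finite_subset by blast
      have "card A \<noteq> 0" using A \<open>finite A\<close> by simp
      moreover have "card A \<noteq> 1"
      proof
        assume "card A = 1"
        then obtain a where "A = {a}" using card_1_singletonE by blast
        then show False using A by auto
      qed
      ultimately have "card A - 1 \<noteq> 0" by simp
      then show "of_int 0 ^ (card A - 1) * grothendieck_beta n 0 (rot i w A) = 0" by simp
    qed
  qed auto
  finally show ?thesis using cotransition[OF assms, of 0] by simp
qed

lemma Phi_subset_Phi_bar: "Phi i w \<subseteq> Phi_bar i w"
proof
  fix u assume "u \<in> Phi i w"
  then obtain a where u: "u = rot i w {a}" and "a \<in> phi i w" unfolding Phi_def by auto
  then have "{a} \<in> {A. finite A \<and> A \<noteq> {} \<and> A \<subseteq> phi i w}" by simp
  then show "u \<in> Phi_bar i w"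
    unfolding Phi_bar_def setcompr_eq_image
    by (rule image_eqI[where x = "{a}", rotated]) (rule u[unfolded rot_def])
qed

lemma finite_Phi_bar:
  assumes "corner n w i j"
  shows "finite (Phi_bar i w)"
proof -
  have "finite (phi i w)" using corner_phi[OF assms] finite_subset by blast
  then show ?thesis unfolding Phi_bar_eq[OF assms] by simp
qed

lemma Phi_bar_Sym:
  assumes "corner n w i j" "u \<in> Phi_bar i w"
  shows "u \<in> Sym n" "weight n u < weight n w"
proof -
  obtain A where A: "A \<noteq> {}" "A \<subseteq> phi i w" and u: "u = rot i w A"
    using assms(2) unfolding Phi_bar_eq[OF assms(1)] by blast
  have "A \<subseteq> {..n}" using A corner_phi[OF assms(1)] by auto
  moreover have "1 \<le> i" "i \<le> n" using assms(1) by (auto simp: corner_def)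
  ultimately show "u \<in> Sym n" "weight n u < weight n w"
    unfolding u using rot_phi(1,3)[OF corner_Sym[OF assms(1)] _ _ A(2)] A(1) by simp_all
qed

text \<open>
  Hence the condition \<open>u \<ge> w s\<^sub>i\<close> in the definition of \<open>R_graph\<close> only discards elements of
  \<open>Phi_bar i w\<close> whose polynomial is killed by \<open>N\<^sub>i\<close>.
\<close>

lemma Phi_bar_ascent:
  assumes c: "corner n w i j" and u: "u \<in> Phi_bar i w" "\<not> bruhat_le (w \<circ> simple i) u"
  shows "u i < u (Suc i)"
proof -
  obtain A where A: "A \<noteq> {}" "A \<subseteq> phi i w" and u_eq: "u = rot i w A"
    using u(1) unfolding Phi_bar_eq[OF c] by blast
  note w = corner_Sym[OF c]
  have i: "1 \<le> i" "i < n" using c by (auto simp: corner_def)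
  note phi = phi_insert[OF corner_ascent[OF c] Sym_imp_inj[OF w]]
  have sub: "A \<subseteq> {Suc i..n}" using A corner_phi[OF c] by blast
  then have fin: "finite A" using finite_subset by blast
  \<comment> \<open>If A contained i + 1, then u would arise from w s_i by the remaining upward
    steps and so lie above it, against the assumption.\<close>
  have "Suc i \<notin> A"
  proof
    assume "Suc i \<in> A"
    define B where "B = A - {Suc i}"
    have AB: "A = insert (Suc i) B" using \<open>Suc i \<in> A\<close> by (auto simp: B_def)
    have "B \<subseteq> phi (Suc i) (w \<circ> simple i)" using A(2) unfolding phi B_def by auto
    moreover have "w \<circ> simple i \<in> Sym n" using w i by (intro Sym_comp simple_in_Sym)
    moreover have "B \<subseteq> {..n}" "finite B" "\<forall>b\<in>B. Suc i < b" using sub fin unfolding B_def by auto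
    ultimately have "bruhat_le (w \<circ> simple i) u"
      unfolding u_eq AB using i by (subst rot_insert_Suc) (auto intro: rot_phi(2))
    then show False using u(2) by blast
  qed
  moreover have "Min A \<in> A" using A(1) fin by simp
  ultimately have "Min A \<in> phi i w" "Min A \<noteq> Suc i" using A(2) by auto
  then have "w (Min A) < w (Suc i)" unfolding phi by blast
  moreover have "i \<notin> A" using sub by auto
  ultimately show ?thesis
    unfolding u_eq using rot_at[OF fin A(1)] rot_outside[OF fin \<open>Suc i \<notin> A\<close>] by simp
qed

section \<open>The dominant part\<close>

lemma rothe_bounded:
  assumes w: "w \<in> Sym n" and r: "(r, c) \<in> rothe w"
  shows "r \<le> n" "c \<le> n"
proof -
  have rc: "1 \<le> r" "1 \<le> c" "c < w r" "r < inv w c" using r by (auto simp: rothe_def)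
  have out: "inv w p = p \<and> w p = p" if "n < p" for p
    using Sym_outside[OF w that] Sym_inv_eq[OF w] by blast
  show "r \<le> n"
  proof (rule ccontr)
    assume "\<not> r \<le> n"
    then have "c < r" "n < inv w c" using out[of r] rc by auto
    then have "w (inv w c) = inv w c" using out by blast
    then show False using Sym_inv[OF w, of c] rc \<open>c < r\<close> by simp
  qed
  then have "w r \<le> n" using Sym_range[OF w rc(1)] by simp
  then show "c \<le> n" using rc by simp
qed

text \<open>Row r may extend as far as the whole rectangle above and to the left stays inside the
  Rothe diagram. These row lengths form the greatest partition, so \<open>GREATEST\<close> denotes
  an actual diagram.\<close>

lemma dom_diagram:
  assumes w: "w \<in> Sym n"
  shows "dom_diagram w \<subseteq> rothe w"
    and "is_partition \<nu> \<Longrightarrow> young \<nu> \<subseteq> rothe w \<Longrightarrow> young \<nu> \<subseteq> dom_diagram w"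
proof -
  \<comment> \<open>The member 0 keeps \<open>S r\<close> nonempty and the bound n keeps it finite,
    even in the junk row 0, so \<open>Max\<close> is meaningful.\<close>
  define S where "S = (\<lambda>r. {c. c \<le> n \<and> (\<forall>r' c'. 1 \<le> r' \<and> r' \<le> r \<and> 1 \<le> c' \<and> c' \<le> c \<longrightarrow> (r', c') \<in> rothe w)})"
  define \<mu> where "\<mu> = (\<lambda>r. Max (S r))"
  have S: "finite (S r)" "S r \<noteq> {}" for r
    unfolding S_def by (auto intro: exI[of _ 0])
  then have \<mu>_in: "\<mu> r \<in> S r" and \<mu>_ge: "c \<in> S r \<Longrightarrow> c \<le> \<mu> r" for r c
    unfolding \<mu>_def by simp_all
  have "is_partition \<mu>"
    unfolding is_partition_def
  proof
    show "antimono_on {1..} \<mu>"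
    proof (rule monotone_onI)
      fix r s :: nat assume "r \<le> s"
      then have "S s \<subseteq> S r" unfolding S_def by auto
      then show "\<mu> s \<le> \<mu> r" using \<mu>_in \<mu>_ge by blast
    qed
    have "{i. 1 \<le> i \<and> \<mu> i \<noteq> 0} \<subseteq> {..n}"
    proof
      fix r assume "r \<in> {i. 1 \<le> i \<and> \<mu> i \<noteq> 0}"
      then have "(r, 1) \<in> rothe w" using \<mu>_in[of r] unfolding S_def by auto
      then show "r \<in> {..n}" using rothe_bounded(1)[OF w] by simp
    qed
    then show "finite {i. 1 \<le> i \<and> \<mu> i \<noteq> 0}" using finite_subset by blast
  qed
  moreover have "young \<mu> \<subseteq> rothe w"
    using \<mu>_in unfolding young_def S_def by blast
  moreover have max: "young \<nu> \<subseteq> young \<mu>" if \<nu>: "is_partition \<nu>" "young \<nu> \<subseteq> rothe w" for \<nu>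
  proof
    fix x assume "x \<in> young \<nu>"
    then obtain r c where x: "x = (r, c)" "1 \<le> r" "1 \<le> c" "c \<le> \<nu> r" by (auto simp: young_def)
    have "(r', c') \<in> rothe w" if "1 \<le> r'" "r' \<le> r" "1 \<le> c'" "c' \<le> c" for r' c'
    proof -
      have "\<nu> r \<le> \<nu> r'" using \<nu>(1) that unfolding is_partition_def monotone_on_def by simp
      then have "(r', c') \<in> young \<nu>" using that x by (simp add: young_def)
      then show ?thesis using \<nu>(2) by blast
    qed
    moreover from this have "c \<le> n" using rothe_bounded(2)[OF w, of r c] x by blast
    ultimately have "c \<in> S r" unfolding S_def by blast
    then show "x \<in> young \<mu>" using \<mu>_ge x by (simp add: young_def)
  qed
  ultimately have "dom_diagram w = young \<mu>"
    unfolding dom_diagram_def by (intro Greatest_equality) auto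
  then show "dom_diagram w \<subseteq> rothe w"
    "is_partition \<nu> \<Longrightarrow> young \<nu> \<subseteq> rothe w \<Longrightarrow> young \<nu> \<subseteq> dom_diagram w"
    using \<open>young \<mu> \<subseteq> rothe w\<close> max by auto
qed

text \<open>Take j to be the least value off its position in \<open>w0 n\<close>. The positions
  right of n + 1 - j are occupied by smaller values, which forces i + j <= n.\<close>

lemma first_non_w0:
  assumes w: "w \<in> Sym n" and "w \<noteq> w0 n"
  obtains j where "corner n w (inv w j) j"
proof -
  define j where "j = (LEAST j. 1 \<le> j \<and> j \<le> n \<and> w (n + 1 - j) \<noteq> j)"
  obtain p where p: "w p \<noteq> w0 n p" using assms(2) by blast
  then have "p \<in> {1..n}" using w w0_in_Sym[of n] by (metis (mono_tags, lifting) Sym_def mem_Collect_eq permutes_def)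
  then have "1 \<le> n + 1 - p \<and> n + 1 - p \<le> n \<and> w (n + 1 - (n + 1 - p)) \<noteq> n + 1 - p"
    using p by (auto simp: w0_def)
  then have j: "1 \<le> j \<and> j \<le> n \<and> w (n + 1 - j) \<noteq> j"
    unfolding j_def by (rule LeastI)
  have less: "w (n + 1 - k) = k" if "1 \<le> k" "k < j" for k
    using not_less_Least[of k "\<lambda>j. 1 \<le> j \<and> j \<le> n \<and> w (n + 1 - j) \<noteq> j"] that j
    unfolding j_def by auto
  define i where "i = inv w j"
  have wi: "w i = j" and i: "1 \<le> i" "i \<le> n"
    unfolding i_def using Sym_inv[OF w] Sym_inv_range[OF w] j by auto
  have "i + j \<le> n"
  proof (rule ccontr)
    assume "\<not> i + j \<le> n"
    moreover have "i \<noteq> n + 1 - j" using wi j by auto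
    ultimately have "n + 1 - i < j" "1 \<le> n + 1 - i" using i by auto
    then have "w i = n + 1 - i" using less[of "n + 1 - i"] i by simp
    then show False using wi \<open>n + 1 - i < j\<close> by simp
  qed
  then have "corner n w i j" unfolding corner_def using w wi i j less by auto
  then show thesis using that i_def by blast
qed

text \<open>In the columns before j the dominant part contains every cell with r + c <= n, so no
  addable cell counted by \<open>alpha\<close> lies there. In column j it ends right above row i,
  since w i = j keeps (i, j) out of the Rothe diagram.\<close>

lemma corner_alpha:
  assumes w: "w \<in> Sym n" and "w \<noteq> w0 n"
  shows "corner n w (inv w (alpha n w)) (alpha n w)"
proof -
  obtain j where c: "corner n w (inv w j) j" using first_non_w0[OF assms] .
  define i where "i = inv w j"
  have ij: "1 \<le> i" "1 \<le> j" "i + j \<le> n" "w i = j"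
    and less: "\<And>k. 1 \<le> k \<Longrightarrow> k < j \<Longrightarrow> w (n + 1 - k) = k"
    using c unfolding corner_def i_def by auto
  \<comment> \<open>The staircase columns before j together with the cells of column j above row i;
    truncated subtraction empties the rows from n on.\<close>
  define \<nu> where "\<nu> = (\<lambda>r. if r < i then j else min (j - 1) (n - r))"
  have "is_partition \<nu>"
    unfolding is_partition_def
  proof
    show "antimono_on {1..} \<nu>" by (rule monotone_onI) (auto simp: \<nu>_def)
    have "{r. 1 \<le> r \<and> \<nu> r \<noteq> 0} \<subseteq> {..n}"
      using ij by (auto simp: \<nu>_def split: if_splits)
    then show "finite {r. 1 \<le> r \<and> \<nu> r \<noteq> 0}" using finite_subset by blast
  qed
  moreover have "young \<nu> \<subseteq> rothe w"
  proof
    fix x assume "x \<in> young \<nu>"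
    then obtain r c where x: "x = (r, c)" "1 \<le> r" "1 \<le> c" "c \<le> \<nu> r" by (auto simp: young_def)
    show "x \<in> rothe w"
    proof (cases "c < j")
      case True
      then have inv: "inv w c = n + 1 - c" using less[OF x(3)] Sym_inv_eq[OF w] by blast
      have rc: "r + c \<le> n" using x True ij by (auto simp: \<nu>_def split: if_splits)
      have "c < w r"
      proof (rule ccontr)
        assume "\<not> c < w r"
        moreover have "1 \<le> w r" using Sym_range[OF w x(2)] rc by simp
        ultimately have "w (n + 1 - w r) = w r" using less[of "w r"] True by simp
        then have "n + 1 - w r = r" using Sym_inj[OF w] by blast
        then show False using \<open>\<not> c < w r\<close> rc by simp
      qed
      then show ?thesis using x rc inv by (simp add: rothe_def)
    next
      case False
      then have "c = j" "r < i" using x ij by (auto simp: \<nu>_def split: if_splits)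
      moreover have "w i < w r"
        using corner_less[OF c x(2)] \<open>r < i\<close> ij unfolding i_def[symmetric] by simp
      ultimately show ?thesis using x ij by (simp add: rothe_def i_def)
    qed
  qed
  ultimately have \<nu>: "young \<nu> \<subseteq> dom_diagram w" by (rule dom_diagram(2)[OF w])
  have "alpha n w = j"
    unfolding alpha_def
  proof (rule Least_equality)
    have "(i, j) \<notin> dom_diagram w"
      using dom_diagram(1)[OF w] ij(4) by (auto simp: rothe_def)
    moreover have "(i - 1, j) \<in> dom_diagram w" if "i > 1"
      using \<nu> that ij by (auto simp: young_def \<nu>_def)
    moreover have "(i, j - 1) \<in> dom_diagram w" if "j > 1"
    proof -
      have "(i, j - 1) \<in> young \<nu>" using that ij by (auto simp: young_def \<nu>_def)
      then show ?thesis using \<nu> by blast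
    qed
    ultimately have "addable (dom_diagram w) i j" unfolding addable_def using ij by blast
    then show "\<exists>i. addable (dom_diagram w) i j \<and> i + j \<le> n" using ij by blast
  next
    fix y assume "\<exists>r. addable (dom_diagram w) r y \<and> r + y \<le> n"
    then obtain r where r: "1 \<le> r" "1 \<le> y" "(r, y) \<notin> dom_diagram w" "r + y \<le> n"
      unfolding addable_def by blast
    show "j \<le> y"
    proof (rule ccontr)
      assume "\<not> j \<le> y"
      then have "(r, y) \<in> young \<nu>" using r by (auto simp: young_def \<nu>_def)
      then show False using r(3) \<nu> by blast
    qed
  qed
  then show ?thesis using c by simp
qed

section \<open>Sums over paths\<close>

lemma paths_w0: "paths (graph_of n T) (w0 n) (w0 n) = {[]}"
proof (intro equalityI subsetI)
  fix p assume "p \<in> paths (graph_of n T) (w0 n) (w0 n)"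
  then show "p \<in> {[]}"
    by (cases p) (auto simp: paths_def pre_digraph.awalk_def pre_digraph.cas.simps graph_of_def)
next
  fix p :: "arc list" assume "p \<in> {[]}"
  then show "p \<in> paths (graph_of n T) (w0 n) (w0 n)"
    by (simp add: paths_def pre_digraph.awalk_def pre_digraph.cas.simps graph_of_def w0_in_Sym)
qed

lemma paths_step:
  fixes T :: "nat \<Rightarrow> perm \<Rightarrow> perm set"
  assumes w: "w \<in> Sym n" "w \<noteq> w0 n" and T: "T (inv w (alpha n w)) w \<subseteq> Phi_bar (inv w (alpha n w)) w"
  shows "paths (graph_of n T) w (w0 n) =
    (\<Union>u\<in>T (inv w (alpha n w)) w.
      (#) (w, (inv w (alpha n w), alpha n w), u) ` paths (graph_of n T) u (w0 n))"
    (is "?L = ?R")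
proof (intro equalityI subsetI)
  fix p assume "p \<in> ?L"
  then obtain e q where "p = e # q" "e \<in> arcs (graph_of n T)" "tail (graph_of n T) e = w"
      "set q \<subseteq> arcs (graph_of n T)" "pre_digraph.cas (graph_of n T) (head (graph_of n T) e) q (w0 n)"
    using w by (cases p) (auto simp: paths_def pre_digraph.awalk_def pre_digraph.cas.simps)
  moreover from this obtain u where "e = (w, (inv w (alpha n w), alpha n w), u)" "u \<in> T (inv w (alpha n w)) w"
    by (auto simp: graph_of_def)
  moreover from this have "u \<in> Sym n"
    using T Phi_bar_Sym(1)[OF corner_alpha[OF w]] by blast
  ultimately show "p \<in> ?R"
    by (auto simp: paths_def pre_digraph.awalk_def graph_of_def)
next
  fix p assume "p \<in> ?R"
  then obtain u q where "p = (w, (inv w (alpha n w), alpha n w), u) # q" "u \<in> T (inv w (alpha n w)) w"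
      "q \<in> paths (graph_of n T) u (w0 n)"
    by (elim UN_E imageE)
  then show "p \<in> ?L"
    using w by (auto simp: paths_def pre_digraph.awalk_def pre_digraph.cas.simps graph_of_def)
qed

lemma sum_paths:
  fixes T :: "nat \<Rightarrow> perm \<Rightarrow> perm set" and F :: "arc list \<Rightarrow> 'a::comm_monoid_add"
  assumes T: "\<And>i w. T i w \<subseteq> Phi_bar i w" and w: "w \<in> Sym n" "w \<noteq> w0 n"
    and fin: "\<And>u. u \<in> T (inv w (alpha n w)) w \<Longrightarrow> finite (paths (graph_of n T) u (w0 n))"
  shows "(\<Sum>p\<in>paths (graph_of n T) w (w0 n). F p) =
    (\<Sum>u\<in>T (inv w (alpha n w)) w. \<Sum>q\<in>paths (graph_of n T) u (w0 n).
       F ((w, (inv w (alpha n w), alpha n w), u) # q))"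
proof -
  define S where "S = T (inv w (alpha n w)) w"
  define C where "C = (\<lambda>u. (#) (w, (inv w (alpha n w), alpha n w), u :: perm))"
  let ?P = "\<lambda>u. paths (graph_of n T) u (w0 n)"
  have "finite S"
    unfolding S_def by (rule finite_subset[OF T finite_Phi_bar[OF corner_alpha[OF w]]])
  moreover have "\<forall>u\<in>S. finite (C u ` ?P u)"
    using fin unfolding S_def by blast
  moreover have "\<forall>u\<in>S. \<forall>v\<in>S. u \<noteq> v \<longrightarrow> C u ` ?P u \<inter> C v ` ?P v = {}"
    unfolding C_def by auto
  ultimately have "sum F (\<Union>u\<in>S. C u ` ?P u) = (\<Sum>u\<in>S. sum F (C u ` ?P u))"
    by (rule sum.UNION_disjoint)
  also have "\<dots> = (\<Sum>u\<in>S. \<Sum>q\<in>?P u. F (C u q))"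
  proof (rule sum.cong[OF HOL.refl])
    fix u
    have "inj_on (C u) (?P u)" by (simp add: C_def)
    then show "sum F (C u ` ?P u) = (\<Sum>q\<in>?P u. F (C u q))"
      by (simp add: sum.reindex)
  qed
  finally show ?thesis unfolding paths_step[where T = T, OF w T] S_def C_def .
qed

lemma finite_paths:
  fixes T :: "nat \<Rightarrow> perm \<Rightarrow> perm set"
  assumes T: "\<And>i w. T i w \<subseteq> Phi_bar i w" and "w \<in> Sym n"
  shows "finite (paths (graph_of n T) w (w0 n))"
  using assms(2)
proof (induction "weight n w" arbitrary: w rule: less_induct)
  case less
  show ?case
  proof (cases "w = w0 n")
    case False
    note c = corner_alpha[OF less.prems False]
    have "finite (T (inv w (alpha n w)) w)"
      by (rule finite_subset[OF T finite_Phi_bar[OF c]])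
    moreover have "finite (paths (graph_of n T) u (w0 n))" if "u \<in> T (inv w (alpha n w)) w" for u
    proof -
      have "u \<in> Phi_bar (inv w (alpha n w)) w" using T that by blast
      then show ?thesis using less.hyps[of u] Phi_bar_Sym[OF c, of u] by simp
    qed
    ultimately show ?thesis
      unfolding paths_step[where T = T, OF less.prems False T] by (intro finite_UN_I finite_imageI)
  qed (simp add: paths_w0)
qed

text \<open>Edges lower the weight. The induction hypothesis covers all of \<open>Phi_bar\<close>,
  so the rule fits each of the three graphs.\<close>

lemma path_induct [consumes 1, case_names w0 step]:
  assumes "w \<in> Sym n"
    and "P (w0 n)"
    and "\<And>w. w \<in> Sym n \<Longrightarrow> w \<noteq> w0 n \<Longrightarrow> corner n w (inv w (alpha n w)) (alpha n w) \<Longrightarrow>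
      (\<And>u. u \<in> Phi_bar (inv w (alpha n w)) w \<Longrightarrow> u \<in> Sym n \<and> P u) \<Longrightarrow> P w"
  shows "P w"
  using assms(1)
proof (induction "weight n w" arbitrary: w rule: less_induct)
  case less
  show ?case
  proof (cases "w = w0 n")
    case False
    note c = corner_alpha[OF less.prems False]
    show ?thesis
    proof (rule assms(3)[OF less.prems False c])
      fix u assume "u \<in> Phi_bar (inv w (alpha n w)) w"
      then show "u \<in> Sym n \<and> P u" using less.hyps[of u] Phi_bar_Sym[OF c, of u] by simp
    qed
  qed (use assms(2) in simp)
qed

section \<open>Iterating a recursion along paths\<close>

lemma row_label_arc [simp]: "row_label (v, (i, j), u) = i"
  by (simp add: row_label_def)

lemma row_label_bounds:
  assumes "p \<in> paths (graph_of n T) w v" "e \<in> set p"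
  shows "1 \<le> row_label e" "row_label e < n"
proof -
  have "e \<in> arcs (graph_of n T)" using assms by (auto simp: paths_def pre_digraph.awalk_def)
  then obtain v u where "e = (v, (inv v (alpha n v), alpha n v), u)" "v \<in> Sym n" "v \<noteq> w0 n"
    by (auto simp: graph_of_def)
  then show "1 \<le> row_label e" "row_label e < n"
    using corner_alpha[of v n] by (auto simp: corner_def)
qed

text \<open>Prepending an edge divides the path term by x_i, matching the recursion of H. The claim
  lives in the fraction field, where x_i is cancelled at the end.\<close>

lemma path_weight_expansion:
  fixes T :: "nat \<Rightarrow> perm \<Rightarrow> perm set"
  assumes T: "\<And>i w. T i w \<subseteq> Phi_bar i w" and H0: "H (w0 n) = staircase n"
    and H: "\<And>w i j. corner n w i j \<Longrightarrow> X i * H w = (\<Sum>u\<in>T i w. H u)"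
    and w: "w \<in> Sym n"
  shows "to_fract (H w) =
    to_fract (staircase n) * (\<Sum>p\<in>paths (graph_of n T) w (w0 n). 1 / to_fract (path_wt p))"
  using w
proof (induction rule: path_induct)
  case w0
  show ?case by (simp add: paths_w0 H0 path_wt_def)
next
  case (step w)
  let ?i = "inv w (alpha n w)"
  let ?P = "\<lambda>u. paths (graph_of n T) u (w0 n)"
  have u: "u \<in> Sym n" "to_fract (H u) = to_fract (staircase n) * (\<Sum>p\<in>?P u. 1 / to_fract (path_wt p))"
    if "u \<in> T ?i w" for u
    using step.IH that T by blast+
  have "to_fract (X ?i) * (to_fract (staircase n) * (\<Sum>p\<in>?P w. 1 / to_fract (path_wt p))) =
    to_fract (staircase n) * (\<Sum>u\<in>T ?i w. \<Sum>p\<in>?P u. to_fract (X ?i) * (1 / to_fract (path_wt ((w, (?i, alpha n w), u) # p))))"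
    using u(1) by (subst sum_paths) (auto simp: T step.hyps finite_paths sum_distrib_left mult_ac)
  also have "(\<Sum>u\<in>T ?i w. \<Sum>p\<in>?P u. to_fract (X ?i) * (1 / to_fract (path_wt ((w, (?i, alpha n w), u) # p)))) =
    (\<Sum>u\<in>T ?i w. \<Sum>p\<in>?P u. 1 / to_fract (path_wt p))"
    by (simp add: path_wt_def)
  also have "to_fract (staircase n) * \<dots> = (\<Sum>u\<in>T ?i w. to_fract (H u))"
    using u(2) by (simp add: sum_distrib_left)
  also have "\<dots> = to_fract (X ?i) * to_fract (H w)"
    using H[OF step.hyps(3)] by (metis to_fract_mult to_fract_sum)
  finally show ?case by simp
qed

text \<open>K p stands for the operators of the edges of p applied to the top polynomial, the first
  edge outermost. Its recursion is demanded only for row labels from 1 to n - 1, where the letters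
  stay inside S_n; \<open>row_label_bounds\<close> supplies this range.\<close>

lemma path_operator_expansion:
  fixes T :: "nat \<Rightarrow> perm \<Rightarrow> perm set"
  assumes T: "\<And>i w. T i w \<subseteq> Phi_bar i w" and H0: "H (w0 n) = K []"
    and H: "\<And>w i j. corner n w i j \<Longrightarrow> H w = (\<Sum>u\<in>T i w. demazure_op \<beta> i (H u))"
    and K: "\<And>e p. \<forall>a\<in>set (e # p). 1 \<le> row_label a \<and> row_label a < n \<Longrightarrow>
      K (e # p) = demazure_op \<beta> (row_label e) (K p)"
    and w: "w \<in> Sym n"
  shows "H w = (\<Sum>p\<in>paths (graph_of n T) w (w0 n). K p)"
  using w
proof (induction rule: path_induct)
  case w0
  show ?case by (simp add: paths_w0 H0)
next
  case (step w)
  let ?i = "inv w (alpha n w)"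
  let ?P = "\<lambda>u. paths (graph_of n T) u (w0 n)"
  have u: "u \<in> Sym n" "H u = (\<Sum>p\<in>?P u. K p)" if "u \<in> T ?i w" for u
    using step.IH that T by blast+
  have i: "1 \<le> ?i" "?i < n" using step.hyps(3) by (auto simp: corner_def)
  have "H w = (\<Sum>u\<in>T ?i w. \<Sum>p\<in>?P u. demazure_op \<beta> ?i (K p))"
    unfolding H[OF step.hyps(3)]
  proof (rule sum.cong[OF HOL.refl])
    fix v assume "v \<in> T ?i w"
    then show "demazure_op \<beta> ?i (H v) = (\<Sum>p\<in>?P v. demazure_op \<beta> ?i (K p))"
      using u(2) demazure_op_sum by metis
  qed
  also have "\<dots> = (\<Sum>u\<in>T ?i w. \<Sum>p\<in>?P u. K ((w, (?i, alpha n w), u) # p))"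
  proof (intro sum.cong HOL.refl)
    fix v p assume "p \<in> ?P v"
    then have "\<forall>a\<in>set ((w, (?i, alpha n w), v) # p). 1 \<le> row_label a \<and> row_label a < n"
      using i row_label_bounds[of p n T v "w0 n"] by simp
    from K[OF this] show "demazure_op \<beta> ?i (K p) = K ((w, (?i, alpha n w), v) # p)"
      by simp
  qed
  also have "\<dots> = (\<Sum>p\<in>?P w. K p)"
    using u(1) by (intro sum_paths[symmetric] T step.hyps finite_paths)
  finally show ?case .
qed

section \<open>Words\<close>

lemma demazure_snoc: "demazure (xs @ [i]) = demazure_step (demazure xs) i"
  by (simp add: demazure_def)

lemma word_prod_snoc: "word_prod (xs @ [i]) = word_prod xs \<circ> simple i"
  by (simp add: word_prod_def)

lemma word_prod_in_Sym: "\<forall>i\<in>set xs. 1 \<le> i \<and> i < n \<Longrightarrow> word_prod xs \<in> Sym n"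
proof (induction xs rule: rev_induct)
  case (snoc i xs)
  then show ?case unfolding word_prod_snoc by (intro Sym_comp simple_in_Sym) auto
qed (simp add: word_prod_def id_in_Sym)

lemma demazure_in_Sym: "\<forall>i\<in>set xs. 1 \<le> i \<and> i < n \<Longrightarrow> demazure xs \<in> Sym n"
proof (induction xs rule: rev_induct)
  case (snoc i xs)
  then have "demazure xs \<circ> simple i \<in> Sym n" by (intro Sym_comp simple_in_Sym) auto
  then show ?case using snoc unfolding demazure_snoc demazure_step_def by auto
qed (simp add: demazure_def id_in_Sym)

lemma len_id: "len id = 0"
proof -
  have "{(i, j). 1 \<le> i \<and> i < j \<and> id i > (id j :: nat)} = {}" by auto
  then show ?thesis unfolding len_def by (simp only: card.empty)
qed

lemma len_word_prod_le: "\<forall>i\<in>set xs. 1 \<le> i \<and> i < n \<Longrightarrow> len (word_prod xs) \<le> length xs"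
proof (induction xs rule: rev_induct)
  case (snoc i xs)
  then have "len (word_prod xs \<circ> simple i) \<le> Suc (len (word_prod xs))"
    by (intro len_simple_le[of _ n] word_prod_in_Sym) auto
  moreover have "len (word_prod xs) \<le> length xs" using snoc by simp
  ultimately have "len (word_prod xs \<circ> simple i) \<le> Suc (length xs)" by linarith
  then show ?case by (simp only: word_prod_snoc length_append_singleton)
qed (simp add: word_prod_def len_id)

text \<open>Each letter raises the length by at most one, so full length is attained only if every
  letter raises it.\<close>

lemma reduced_word_snoc:
  assumes "\<forall>i\<in>set (xs @ [i]). 1 \<le> i \<and> i < n"
  shows "reduced_word (xs @ [i]) \<longleftrightarrow> reduced_word xs \<and> len (word_prod xs) < len (word_prod xs \<circ> simple i)"
proof -
  have xs: "\<forall>i\<in>set xs. 1 \<le> i \<and> i < n" and i: "1 \<le> i" "i < n" using assms by auto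
  note v = word_prod_in_Sym[OF xs]
  show ?thesis
    using len_word_prod_le[OF xs] len_simple_le[OF v i]
    unfolding reduced_word_def word_prod_snoc by auto
qed

lemma demazure_reduced_word:
  "\<forall>i\<in>set xs. 1 \<le> i \<and> i < n \<Longrightarrow> reduced_word xs \<Longrightarrow> demazure xs = word_prod xs"
proof (induction xs rule: rev_induct)
  case (snoc i xs)
  then have "reduced_word xs" "len (word_prod xs) < len (word_prod xs \<circ> simple i)"
    using reduced_word_snoc by blast+
  then show ?case using snoc by (simp add: demazure_snoc word_prod_snoc demazure_step_def)
qed (simp add: demazure_def word_prod_def)

text \<open>Left multiplication by \<open>w0 n\<close> reverses values, so the ascents of v are the
  descents at which the operator moves the polynomial.\<close>

lemma demazure_op_w0_comp:
  assumes v: "v \<in> Sym n" and i: "1 \<le> i" "i < n"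
  shows "demazure_op \<beta> i (grothendieck_beta n \<beta> (w0 n \<circ> v)) =
    (if len v < len (v \<circ> simple i) then grothendieck_beta n \<beta> (w0 n \<circ> (v \<circ> simple i))
     else - of_int \<beta> * grothendieck_beta n \<beta> (w0 n \<circ> v))"
proof -
  have less: "(w0 n \<circ> v) (Suc i) < (w0 n \<circ> v) i \<longleftrightarrow> v i < v (Suc i)"
    using Sym_range[OF v] i by (simp add: w0_less_iff)
  show ?thesis
    unfolding demazure_op_grothendieck_beta[OF Sym_comp[OF w0_in_Sym v] i] less
      len_simple_less_iff[OF assms] comp_assoc ..
qed

lemma path_word_Cons: "path_word (e # p) = path_word p @ [row_label e]"
  by (simp add: path_word_def)

lemma set_path_word: "set (path_word p) = row_label ` set p"
  by (simp add: path_word_def)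

text \<open>With parameter -1 the scalar -\<beta> is 1, so a letter that does not lengthen fixes the
  polynomial just as it fixes the Demazure product. As \<open>path_word\<close> reverses the path,
  the first edge is the last letter.\<close>

lemma grothendieck_path_word:
  assumes "\<forall>a\<in>set (e # p). 1 \<le> row_label a \<and> row_label a < n"
  shows "grothendieck n (w0 n \<circ> demazure (path_word (e # p))) =
    demazure_op (-1) (row_label e) (grothendieck n (w0 n \<circ> demazure (path_word p)))"
proof -
  have "demazure (path_word p) \<in> Sym n"
    using assms by (intro demazure_in_Sym) (auto simp: set_path_word)
  then show ?thesis
    unfolding grothendieck_def path_word_Cons demazure_snoc demazure_step_def
    using assms by (simp add: demazure_op_w0_comp)
qed

text \<open>With parameter 0 the scalar -\<beta> vanishes, so a letter that does not lengthen kills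
  the polynomial, in step with the word ceasing to be reduced. The value 0 then persists, as
  appending letters never restores reducedness.\<close>

lemma schubert_path_word:
  fixes n :: nat
  defines "K \<equiv> \<lambda>p. if reduced_path p then grothendieck_beta n 0 (w0 n \<circ> demazure (path_word p)) else 0"
  assumes "\<forall>a\<in>set (e # p). 1 \<le> row_label a \<and> row_label a < n"
  shows "K (e # p) = demazure_op 0 (row_label e) (K p)"
proof -
  let ?xs = "path_word p" and ?i = "row_label e"
  have xsi: "\<forall>i\<in>set (?xs @ [?i]). 1 \<le> i \<and> i < n" using assms(2) by (auto simp: set_path_word)
  then have xs: "\<forall>i\<in>set ?xs. 1 \<le> i \<and> i < n" and i: "1 \<le> ?i" "?i < n" by auto
  show ?thesis
  proof (cases "reduced_word ?xs")
    case True
    note eq = demazure_reduced_word[OF xs True]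
    show ?thesis
      unfolding K_def reduced_path_def path_word_Cons reduced_word_snoc[OF xsi]
        demazure_snoc demazure_step_def eq
      using True by (simp add: demazure_op_w0_comp[OF word_prod_in_Sym[OF xs] i])
  next
    case False
    then show ?thesis
      unfolding K_def reduced_path_def path_word_Cons reduced_word_snoc[OF xsi]
      by (simp add: demazure_op_symmetric)
  qed
qed

text \<open>At an ascent the polynomial is symmetric, so N_i undoes multiplication by x_i although
  the parameter is 1. The edges missing from \<open>R_graph\<close> lead to polynomials symmetric in
  x_i and x_(i+1), which N_i annihilates.\<close>

lemma R_graph_step:
  assumes c: "corner n w i j"
  shows "grothendieck_beta n 1 w =
    (\<Sum>u\<in>{u \<in> Phi_bar i w. bruhat_le (w \<circ> simple i) u}. demazure_op 0 i (grothendieck_beta n 1 u))"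
proof -
  have i: "1 \<le> i" "i < n" using c by (auto simp: corner_def)
  have "grothendieck_beta n 1 w = demazure_op 0 i (X i * grothendieck_beta n 1 w)"
    by (intro demazure_op_X_mult_symmetric[symmetric] swap_vars_grothendieck_beta corner_Sym[OF c]
        corner_ascent[OF c] i)
  also have "\<dots> = (\<Sum>u\<in>Phi_bar i w. demazure_op 0 i (grothendieck_beta n 1 u))"
    unfolding X_mult_grothendieck_beta_1[OF c] demazure_op_sum ..
  also have "\<dots> = (\<Sum>u\<in>{u \<in> Phi_bar i w. bruhat_le (w \<circ> simple i) u}. demazure_op 0 i (grothendieck_beta n 1 u))"
  proof (rule sum.mono_neutral_right[OF finite_Phi_bar[OF c]])
    show "\<forall>u\<in>Phi_bar i w - {u \<in> Phi_bar i w. bruhat_le (w \<circ> simple i) u}.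
        demazure_op 0 i (grothendieck_beta n 1 u) = 0"
    proof
      fix u assume u: "u \<in> Phi_bar i w - {u \<in> Phi_bar i w. bruhat_le (w \<circ> simple i) u}"
      then have "u i < u (Suc i)" using Phi_bar_ascent[OF c] by blast
      moreover have "u \<in> Sym n" using Phi_bar_Sym(1)[OF c] u by blast
      ultimately show "demazure_op 0 i (grothendieck_beta n 1 u) = 0"
        using swap_vars_grothendieck_beta[OF _ i] by (simp add: demazure_op_symmetric)
    qed
  qed blast
  finally show ?thesis .
qed

lemma G_graph_step:
  assumes c: "corner n w i j"
  shows "grothendieck_beta n 0 w = (\<Sum>u\<in>Phi i w. demazure_op \<beta> i (grothendieck_beta n 0 u))"
proof -
  have i: "1 \<le> i" "i < n" using c by (auto simp: corner_def)
  have "grothendieck_beta n 0 w = demazure_op \<beta> i (X i * grothendieck_beta n 0 w)"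
    by (intro demazure_op_X_mult_symmetric[symmetric] swap_vars_grothendieck_beta corner_Sym[OF c]
        corner_ascent[OF c] i)
  then show ?thesis unfolding X_mult_grothendieck_beta_0[OF c] demazure_op_sum .
qed

theorem theorem6p7:
  fixes n :: nat and w :: "nat \<Rightarrow> nat"
  assumes "n \<ge> 1" and "w \<in> Sym n"
  shows
    "to_fract (grothendieck_beta n 1 w)
       = to_fract (staircase n) * (\<Sum>p\<in>paths (G_bar_graph n) w (w0 n). 1 / to_fract (path_wt p))
     \<and> to_fract (schubert n w)
       = to_fract (staircase n) * (\<Sum>p\<in>paths (G_graph n) w (w0 n). 1 / to_fract (path_wt p))
     \<and> grothendieck_beta n 1 w
       = (\<Sum>p\<in>{p \<in> paths (R_graph n) w (w0 n). reduced_path p}.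
            schubert n (w0 n \<circ> demazure (path_word p)))
     \<and> schubert n w
       = (\<Sum>p\<in>paths (G_graph n) w (w0 n). grothendieck n (w0 n \<circ> demazure (path_word p)))"
proof (intro conjI)
  note w = assms(2)
  show "to_fract (grothendieck_beta n 1 w)
       = to_fract (staircase n) * (\<Sum>p\<in>paths (G_bar_graph n) w (w0 n). 1 / to_fract (path_wt p))"
    unfolding G_bar_graph_def
    by (rule path_weight_expansion[where T = Phi_bar and H = "grothendieck_beta n 1",
          OF subset_refl grothendieck_beta_w0 X_mult_grothendieck_beta_1 w])
  show "to_fract (schubert n w)
       = to_fract (staircase n) * (\<Sum>p\<in>paths (G_graph n) w (w0 n). 1 / to_fract (path_wt p))"
    unfolding G_graph_def schubert_eq_grothendieck_beta
    by (rule path_weight_expansion[where T = Phi and H = "grothendieck_beta n 0",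
          OF Phi_subset_Phi_bar grothendieck_beta_w0 X_mult_grothendieck_beta_0 w])
  let ?R = "\<lambda>i w. {u \<in> Phi_bar i w. bruhat_le (w \<circ> simple i) u}"
  let ?K = "\<lambda>p. if reduced_path p then grothendieck_beta n 0 (w0 n \<circ> demazure (path_word p)) else 0"
  \<comment> \<open>The empty word is reduced with the identity as Demazure product, so the
    recursion starts at the polynomial of \<open>w0 n\<close>.\<close>
  have "?K [] = staircase n"
    by (simp add: reduced_path_def reduced_word_def word_prod_def path_word_def demazure_def len_id
        grothendieck_beta_w0)
  then have "grothendieck_beta n 1 w = (\<Sum>p\<in>paths (graph_of n ?R) w (w0 n). ?K p)"
    by (intro path_operator_expansion[where \<beta> = 0 and T = ?R and H = "grothendieck_beta n 1" and K = ?K,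
          OF _ _ R_graph_step schubert_path_word w])
       (auto simp only: grothendieck_beta_w0)
  moreover have "finite (paths (graph_of n ?R) w (w0 n))"
    by (rule finite_paths[OF _ w]) blast
  ultimately show "grothendieck_beta n 1 w
       = (\<Sum>p\<in>{p \<in> paths (R_graph n) w (w0 n). reduced_path p}.
            schubert n (w0 n \<circ> demazure (path_word p)))"
    unfolding R_graph_def schubert_eq_grothendieck_beta by (simp add: sum.inter_filter)
  have "grothendieck_beta n 0 (w0 n) = grothendieck n (w0 n \<circ> demazure (path_word []))"
    by (simp add: grothendieck_def path_word_def demazure_def grothendieck_beta_w0)
  then show "schubert n w
       = (\<Sum>p\<in>paths (G_graph n) w (w0 n). grothendieck n (w0 n \<circ> demazure (path_word p)))"
    unfolding G_graph_def schubert_eq_grothendieck_beta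
    by (intro path_operator_expansion[where \<beta> = "-1" and T = Phi and H = "grothendieck_beta n 0"
          and K = "\<lambda>p. grothendieck n (w0 n \<circ> demazure (path_word p))",
          OF Phi_subset_Phi_bar _ G_graph_step grothendieck_path_word w])
qed

end
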